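(* Let $q\ge 8$ be a power of $2$ and $G=\mathrm{PSL}_2(\mathbf{F}_q)=\mathrm{SL}_2(\mathbf{F}_q)$. Let $\mathcal{F}$ be an algebraic closure of $\mathbf{F}_2$ and let $\rho:G\to\mathrm{Aut}(V)$ be an absolutely irreducible faithful representation of $G$ over $\mathcal{F}$. If the trace map $\mathrm{tr}_\rho:G\to\mathcal{F}$, $g\mapsto \mathrm{tr}(\rho(g))$, takes on values in $\mathbf{F}_2$, then $\dim_{\mathcal{F}}(V)=q$. In particular, $\rho$ is (isomorphic to) the Steinberg representation of $G$.
   Context: The Steinberg representation of $G=\mathrm{SL}_2(\mathbf{F}_q)$ over $\mathcal{F}$ is the irreducible representation (unique up to isomorphism) of dimension equal to the largest power of $2$ dividing $\#(G)$, that is, of dimension $q$; concretely it is the space of functions $h:\mathbf{P}^1(\mathbf{F}_q)\to\mathcal{F}$ with $\sum_{x}h(x)=0$, on which $G$ acts through its natural action on $\mathbf{P}^1(\mathbf{F}_q)$. *)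

theory Defs
  imports
    "HOL-Analysis.Analysis"
    "HOL-Algebra.Algebraic_Closure_Type"
    "HOL-Algebra.Group_Action"
    "HOL-Library.Function_Algebras"
begin

section \<open>Finite-dimensional linear representations\<close>

text \<open>
  The representation space is a subspace \<open>V\<close> of an ambient vector space (possibly all of it).
  A \<open>group_action\<close> is a homomorphism into the group of bijections of \<open>V\<close> (as functions
  that are \<open>undefined\<close> outside \<open>V\<close>), so adding linearity of each \<open>\<rho> g\<close> says that \<open>\<rho>\<close> is a
  homomorphism from \<open>G\<close> to \<open>Aut(V)\<close>.
\<close>

locale linear_rep = vector_space smul + group_action G V \<rho>
  for smul :: "'f::field \<Rightarrow> 'v::ab_group_add \<Rightarrow> 'v"
    and G :: "('g, 'm) monoid_scheme" (structure)
    and V :: "'v set" and \<rho> :: "'g \<Rightarrow> 'v \<Rightarrow> 'v" +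
  assumes subspace: "subspace V"
    and finite_dim: "\<exists>B. finite B \<and> V \<subseteq> span B"
    and rho_add: "\<lbrakk>g \<in> carrier G; x \<in> V; y \<in> V\<rbrakk> \<Longrightarrow> \<rho> g (x + y) = \<rho> g x + \<rho> g y"
    and rho_scale: "\<lbrakk>g \<in> carrier G; x \<in> V\<rbrakk> \<Longrightarrow> \<rho> g (smul c x) = smul c (\<rho> g x)"

definition invariant_subspace ::
  "('f::field \<Rightarrow> 'v::ab_group_add \<Rightarrow> 'v) \<Rightarrow> ('g, 'm) monoid_scheme \<Rightarrow> 'v set \<Rightarrow> ('g \<Rightarrow> 'v \<Rightarrow> 'v)
    \<Rightarrow> 'v set \<Rightarrow> bool"
  where "invariant_subspace smul G V \<rho> W \<longleftrightarrow>
    module.subspace smul W \<and> W \<subseteq> V \<and> (\<forall>g\<in>carrier G. \<forall>w\<in>W. \<rho> g w \<in> W)"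

definition irreducible_rep ::
  "('f::field \<Rightarrow> 'v::ab_group_add \<Rightarrow> 'v) \<Rightarrow> ('g, 'm) monoid_scheme \<Rightarrow> 'v set \<Rightarrow> ('g \<Rightarrow> 'v \<Rightarrow> 'v)
    \<Rightarrow> bool"
  where "irreducible_rep smul G V \<rho> \<longleftrightarrow>
    linear_rep smul G V \<rho> \<and> V \<noteq> {0} \<and>
    (\<forall>W. invariant_subspace smul G V \<rho> W \<longrightarrow> W = {0} \<or> W = V)"

definition rep_iso ::
  "('g, 'm) monoid_scheme
    \<Rightarrow> ('f::field \<Rightarrow> 'v::ab_group_add \<Rightarrow> 'v) \<Rightarrow> 'v set \<Rightarrow> ('g \<Rightarrow> 'v \<Rightarrow> 'v)
    \<Rightarrow> ('f \<Rightarrow> 'w::ab_group_add \<Rightarrow> 'w) \<Rightarrow> 'w set \<Rightarrow> ('g \<Rightarrow> 'w \<Rightarrow> 'w) \<Rightarrow> bool"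
  where "rep_iso G smulV V \<rho> smulW W \<sigma> \<longleftrightarrow>
    (\<exists>\<phi>. bij_betw \<phi> V W \<and>
         (\<forall>x\<in>V. \<forall>y\<in>V. \<phi> (x + y) = \<phi> x + \<phi> y) \<and>
         (\<forall>c. \<forall>x\<in>V. \<phi> (smulV c x) = smulW c (\<phi> x)) \<and>
         (\<forall>g\<in>carrier G. \<forall>x\<in>V. \<phi> (\<rho> g x) = \<sigma> g (\<phi> x)))"

definition basis_of :: "('f::field \<Rightarrow> 'v::ab_group_add \<Rightarrow> 'v) \<Rightarrow> 'v set \<Rightarrow> 'v set \<Rightarrow> bool"
  where "basis_of smul V B \<longleftrightarrow> \<not> module.dependent smul B \<and> module.span smul B = V"

definition endo_trace :: "('f::field \<Rightarrow> 'v::ab_group_add \<Rightarrow> 'v) \<Rightarrow> 'v set \<Rightarrow> ('v \<Rightarrow> 'v) \<Rightarrow> 'f"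
  where "endo_trace smul V T =
    (let B = (SOME B. basis_of smul V B) in \<Sum>b\<in>B. module.representation smul B (T b) b)"

definition fun_scale :: "'f::field \<Rightarrow> ('i \<Rightarrow> 'f) \<Rightarrow> ('i \<Rightarrow> 'f)"
  where "fun_scale c h = (\<lambda>i. c * h i)"

text \<open>
  Extension of scalars along a field homomorphism \<open>\<iota>\<close> from \<open>F\<close> to \<open>E\<close>: for a finite basis \<open>B\<close> of
  \<open>V\<close>, the space \<open>E \<otimes> V\<close> has the \<open>E\<close>-basis \<open>1 \<otimes> b\<close>, so it is the space of functions
  \<open>x\<close> from \<open>B\<close> to \<open>E\<close> (extended by \<open>0\<close>), and \<open>g\<close> acts by the matrix of \<open>\<rho> g\<close> with respect to
  \<open>B\<close>, with entries mapped by \<open>\<iota>\<close>.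
\<close>

definition ext_space :: "'v set \<Rightarrow> ('v \<Rightarrow> 'e::field) set"
  where "ext_space B = {x. \<forall>b. b \<notin> B \<longrightarrow> x b = 0}"

definition ext_action ::
  "('f \<Rightarrow> 'e::field) \<Rightarrow> ('f::field \<Rightarrow> 'v::ab_group_add \<Rightarrow> 'v) \<Rightarrow> 'v set \<Rightarrow> ('g \<Rightarrow> 'v \<Rightarrow> 'v)
    \<Rightarrow> 'g \<Rightarrow> ('v \<Rightarrow> 'e) \<Rightarrow> ('v \<Rightarrow> 'e)"
  where "ext_action \<iota> smul B \<rho> g =
    (\<lambda>x\<in>ext_space B. \<lambda>b'. \<Sum>b\<in>B. \<iota> (module.representation smul B (\<rho> g b) b') * x b)"

text \<open>
  Absolute irreducibility: irreducibility after extension of scalars to an algebraic closure of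
  the ground field.
\<close>

definition absolutely_irreducible_rep ::
  "('f::field \<Rightarrow> 'v::ab_group_add \<Rightarrow> 'v) \<Rightarrow> ('g, 'm) monoid_scheme \<Rightarrow> 'v set \<Rightarrow> ('g \<Rightarrow> 'v \<Rightarrow> 'v)
    \<Rightarrow> bool"
  where "absolutely_irreducible_rep smul G V \<rho> \<longleftrightarrow>
    linear_rep smul G V \<rho> \<and>
    (\<exists>B. basis_of smul V B \<and>
       irreducible_rep fun_scale G (ext_space B :: ('v \<Rightarrow> 'f alg_closure) set)
         (ext_action to_ac smul B \<rho>))"


section \<open>The group and its Steinberg representation\<close>

definition SL2 :: "('k::field^2^2) monoid"
  where "SL2 = \<lparr>carrier = {A. det A = 1}, monoid.mult = (**), one = mat 1\<rparr>"

text \<open>Points of the projective line are the lines through the origin of \<open>k\<^sup>2\<close>.\<close>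

definition projective_line :: "('k::field^2) set set"
  where "projective_line = {vec.span {v} | v. v \<noteq> 0}"

text \<open>
  Functions on the projective line are represented as functions on all sets of vectors that
  vanish outside it.
\<close>

definition steinberg_space :: "(('k::field^2) set \<Rightarrow> 'f::field) set"
  where "steinberg_space =
    {h. (\<forall>L. L \<notin> projective_line \<longrightarrow> h L = 0) \<and> (\<Sum>L\<in>projective_line. h L) = 0}"

definition steinberg_action ::
  "'k::field^2^2 \<Rightarrow> (('k^2) set \<Rightarrow> 'f::field) \<Rightarrow> (('k^2) set \<Rightarrow> 'f)"
  where "steinberg_action A =
    (\<lambda>h\<in>steinberg_space. \<lambda>L. h ((\<lambda>v. (inv\<^bsub>SL2\<^esub> A) *v v) ` L))"

end

theory Submission
  imports Defs
begin

text \<open>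
  Let \<open>U\<close> be the group of upper unitriangular matrices, \<open>T\<close> the diagonal torus and \<open>w\<close> the Weyl
  element. As \<open>U\<close> is a 2-group and \<open>V\<close> has characteristic two, \<open>V\<close> contains a nonzero vector \<open>v\<close>
  that is fixed by \<open>U\<close> and is an eigenvector of \<open>T\<close>, say with character \<open>\<theta>\<close>
  (\<open>exists_weight_vector\<close>). The proof shows that \<open>\<theta>\<close> can be taken to be trivial, and that a vector
  of trivial weight makes \<open>V\<close> a quotient, and then a copy, of the Steinberg representation.

  For the first part, suppose that \<open>\<theta>\<close> is not trivial. Then the sum of the elements of \<open>U\<close> kills
  \<open>w v\<close> (\<open>unip_sum_nontrivial_weight\<close>), and the Bruhat decomposition shows that \<open>w v\<close> generates \<open>V\<close>
  over the group algebra of \<open>U\<close>. This has two consequences. An element \<open>\<alpha>\<close> of that group algebra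
  with \<open>\<alpha> w v = v\<close> is an operator of rank one with image spanned by \<open>v\<close>; and all weights of
  \<open>U\<close>-fixed vectors with this property agree (\<open>weight_unique\<close>), because in characteristic two the
  square of an element of the group algebra of \<open>U\<close> is the square of its augmentation. Now let
  \<open>\<alpha>'\<close> arise from \<open>\<alpha>\<close> by squaring the coefficients. Since the traces of group elements lie in the
  prime field, the trace of \<open>h \<alpha>' g\<close> is the square of the trace of \<open>h \<alpha> g\<close> for all \<open>g\<close> and \<open>h\<close> in
  the group. The rank one operator \<open>\<alpha>\<close> also makes the trace pairing with group elements
  nondegenerate, and it follows that the image of \<open>\<alpha>'\<close> is nonzero and consists of \<open>U\<close>-fixed
  vectors of weight \<open>\<theta>\<^sup>2\<close> (\<open>squared_weight\<close>). With \<open>\<theta>\<close> also \<open>\<theta>\<^sup>2\<close> is not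
  trivial, so the uniqueness of the weight gives \<open>\<theta>\<^sup>2 = \<theta>\<close>, which is absurd. In terms of
  representations, \<open>V\<close> is isomorphic to its Frobenius twist, but the argument never leaves \<open>V\<close>.

  For the second part, let \<open>v\<close> have trivial weight. It is fixed by the Borel subgroup \<open>T U\<close>, so its
  orbit is parametrised by the projective line, and summing over the orbit with given coefficients
  is an equivariant map from functions on the projective line to \<open>V\<close>. The constant function \<open>1\<close> is
  mapped to a fixed vector, which vanishes because \<open>V\<close> is irreducible and faithful. Therefore \<open>v\<close> is
  the sum of the \<open>q\<close> vectors \<open>u w v\<close> with \<open>u\<close> in \<open>U\<close>. These vectors span \<open>V\<close> by the Bruhat
  decomposition, and they are independent, because a nonzero ideal of the group algebra of \<open>U\<close>
  contains the sum of all elements of \<open>U\<close>, which maps \<open>w v\<close> to \<open>v\<close> (\<open>unip_comb_eq_0_iff\<close>). So the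
  dimension of \<open>V\<close> is \<open>q\<close>, and the map from functions to vectors is bijective on the functions
  whose values sum to zero (\<open>bij_orbit_sum\<close>).
\<close>

section \<open>Two-by-two matrices in characteristic two\<close>

lemma double_eq_0:
  fixes a :: "'a::ring_1"
  assumes "(1::'a) + 1 = 0"
  shows "a + a = 0"
  by (metis assms distrib_left mult.right_neutral mult_zero_right)

lemma uminus_eq_self:
  fixes a :: "'a::ring_1"
  assumes "(1::'a) + 1 = 0"
  shows "- a = a"
  using double_eq_0[OF assms, of a] by (rule minus_unique)

definition unip :: "'k::field \<Rightarrow> 'k^2^2"
  where "unip x = vector [vector [1, x], vector [0, 1]]"

definition torus :: "'k::field \<Rightarrow> 'k^2^2"
  where "torus a = vector [vector [a, 0], vector [0, inverse a]]"

text \<open>The determinant is \<open>-1\<close>, so no sign has to be inserted in characteristic two.\<close>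

definition weyl :: "'k::field^2^2"
  where "weyl = vector [vector [0, 1], vector [1, 0]]"

lemmas matrix_2_simps = unip_def torus_def weyl_def matrix_matrix_mult_def vec_eq_iff forall_2
  sum_2 det_2 mat_def

lemma unip_0: "unip 0 = mat 1"
  by (simp add: matrix_2_simps)

lemma unip_mult: "unip x ** unip y = unip (x + y)"
  by (simp add: matrix_2_simps add.commute)

lemma torus_mult: "torus a ** torus b = torus (a * b)"
  by (simp add: matrix_2_simps)

lemma torus_unip: "a \<noteq> 0 \<Longrightarrow> torus a ** unip x = unip (a\<^sup>2 * x) ** torus a"
  by (simp add: matrix_2_simps power2_eq_square)

lemma torus_weyl: "torus a ** weyl = weyl ** torus (inverse a)"
  by (simp add: matrix_2_simps)

lemma weyl_weyl: "weyl ** weyl = mat 1"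
  by (simp add: matrix_2_simps)

text \<open>Outside the identity, a lower unitriangular matrix lies in the big cell.\<close>

lemma weyl_unip_weyl:
  fixes x :: "'k::field"
  assumes "(1::'k) + 1 = 0" and "x \<noteq> 0"
  shows "weyl ** (unip x ** weyl) = unip (inverse x) ** (weyl ** (torus x ** unip (inverse x)))"
  using assms double_eq_0[OF assms(1), of "inverse x"] by (simp add: matrix_2_simps)

lemma det_unip: "det (unip x) = 1"
  by (simp add: matrix_2_simps)

lemma det_torus: "a \<noteq> 0 \<Longrightarrow> det (torus a) = 1"
  by (simp add: matrix_2_simps)

lemma det_weyl:
  assumes "(1::'k::field) + 1 = 0"
  shows "det (weyl :: 'k^2^2) = 1"
  using uminus_eq_self[OF assms, of 1] by (simp add: matrix_2_simps)

lemma big_cell_mult: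
  "c \<noteq> 0 \<Longrightarrow> unip (p / c) ** (weyl ** (torus c ** unip (d / c))) =
    vector [vector [p, inverse c + p * d / c], vector [c, d]]"
  by (simp add: matrix_2_simps)

text \<open>Bruhat decomposition: the big cell consists of the matrices whose lower left entry does not
  vanish.\<close>

lemma bruhat:
  fixes A :: "'k::field^2^2"
  assumes char: "(1::'k) + 1 = 0" and det: "det A = 1"
  obtains (borel) a y where "a \<noteq> 0" "A = torus a ** unip y"
  | (big_cell) x a y where "a \<noteq> 0" "A = unip x ** (weyl ** (torus a ** unip y))"
proof (cases "A $ 2 $ 1 = 0")
  case True
  have "A $ 1 $ 1 * A $ 2 $ 2 = 1"
    using det True by (simp add: det_2)
  then have inv: "inverse (A $ 1 $ 1) = A $ 2 $ 2"
    by (rule inverse_unique)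
  have nz: "A $ 1 $ 1 \<noteq> 0"
    using \<open>A $ 1 $ 1 * A $ 2 $ 2 = 1\<close> by (metis mult_zero_left zero_neq_one)
  have "A = torus (A $ 1 $ 1) ** unip (A $ 1 $ 2 / A $ 1 $ 1)"
    using nz inv True by (simp add: matrix_2_simps)
  with nz show ?thesis
    by (rule borel)
next
  case False
  let ?c = "A $ 2 $ 1"
  have "A $ 1 $ 1 * A $ 2 $ 2 = 1 + A $ 1 $ 2 * ?c"
    using det unfolding det_2 by (rule iffD1[OF diff_eq_eq])
  then have "A $ 1 $ 1 * A $ 2 $ 2 / ?c = inverse ?c + A $ 1 $ 2"
    by (simp only: add_divide_distrib inverse_eq_divide nonzero_mult_div_cancel_right[OF False])
  then have "inverse ?c + A $ 1 $ 1 * A $ 2 $ 2 / ?c = A $ 1 $ 2"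
    by (simp only: double_eq_0[OF char] add_0 flip: add.assoc)
  then have "A = vector [vector [A $ 1 $ 1, inverse ?c + A $ 1 $ 1 * A $ 2 $ 2 / ?c],
      vector [?c, A $ 2 $ 2]]"
    by (simp add: vec_eq_iff forall_2)
  also have "\<dots> = unip (A $ 1 $ 1 / ?c) ** (weyl ** (torus ?c ** unip (A $ 2 $ 2 / ?c)))"
    by (rule big_cell_mult [symmetric, OF False])
  finally have "A = unip (A $ 1 $ 1 / ?c) ** (weyl ** (torus ?c ** unip (A $ 2 $ 2 / ?c)))" .
  with False show ?thesis
    by (rule big_cell)
qed

lemma carrier_SL2: "A \<in> carrier SL2 \<longleftrightarrow> det A = 1"
  by (simp add: SL2_def)

lemma mult_SL2: "A \<otimes>\<^bsub>SL2\<^esub> B = A ** B"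
  by (simp add: SL2_def)

lemma one_SL2: "\<one>\<^bsub>SL2\<^esub> = mat 1"
  by (simp add: SL2_def)

section \<open>The projective line as a homogeneous space\<close>

definition line_act :: "'k::field^2^2 \<Rightarrow> ('k^2) set \<Rightarrow> ('k^2) set"
  where "line_act A L = (\<lambda>v. A *v v) ` L"

definition line_at_infinity :: "('k::field^2) set"
  where "line_at_infinity = vec.span {vector [1, 0]}"

definition affine_line :: "'k::field \<Rightarrow> ('k^2) set"
  where "affine_line x = vec.span {vector [x, 1]}"

lemma line_act_mult: "line_act (A ** B) L = line_act A (line_act B L)"
  by (simp add: line_act_def image_image matrix_vector_mul_assoc)

lemma line_act_one: "line_act (mat 1) L = L"
  by (simp add: line_act_def)

lemma line_act_span: "line_act A (vec.span {v}) = vec.span {A *v v}"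
  by (auto simp: line_act_def vec.span_singleton image_image vector_scalar_commute)

lemma vector_2_mult:
  fixes A :: "'k::field^2^2"
  shows "A *v vector [a, b] =
    vector [A $ 1 $ 1 * a + A $ 1 $ 2 * b, A $ 2 $ 1 * a + A $ 2 $ 2 * b]"
  by (simp add: vec_eq_iff forall_2 matrix_vector_mult_def sum_2)

lemma line_act_infinity:
  "line_act (A :: 'k::field^2^2) line_at_infinity = vec.span {vector [A $ 1 $ 1, A $ 2 $ 1]}"
  by (simp add: line_at_infinity_def line_act_span vector_2_mult)

lemma in_line_at_infinity: "x \<in> line_at_infinity \<longleftrightarrow> x $ 2 = 0"
proof
  assume "x $ 2 = 0"
  then have "x = x $ 1 *s vector [1, 0]"
    by (simp add: vec_eq_iff forall_2)
  then show "x \<in> line_at_infinity"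
    unfolding line_at_infinity_def vec.span_singleton by blast
qed (auto simp: line_at_infinity_def vec.span_singleton)

lemma line_act_torus:
  fixes a :: "'k::field"
  assumes "a \<noteq> 0"
  shows "line_act (torus a) line_at_infinity = line_at_infinity"
proof -
  have "vector [a, 0] = a *s (vector [1, 0] :: 'k^2)"
    by (simp add: vec_eq_iff forall_2)
  moreover have "torus a $ 1 $ 1 = a" "torus a $ 2 $ 1 = 0"
    by (simp_all add: torus_def)
  ultimately show ?thesis
    using assms vec.span_image_scale[of "{vector [1, 0] :: 'k^2}" "\<lambda>_. a"]
    unfolding line_act_infinity unfolding line_at_infinity_def by simp
qed

lemma line_act_unip: "line_act (unip x) line_at_infinity = line_at_infinity"
  unfolding line_act_infinity unfolding line_at_infinity_def by (simp add: unip_def)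

lemma line_act_unip_weyl: "line_act (unip x ** weyl) line_at_infinity = affine_line x"
  by (simp add: line_act_infinity affine_line_def matrix_2_simps)

lemma affine_line_neq_infinity: "affine_line x \<noteq> line_at_infinity"
proof
  assume "affine_line x = line_at_infinity"
  moreover have "vector [x, 1] \<in> affine_line x"
    unfolding affine_line_def by (rule vec.span_base) simp
  ultimately show False
    by (simp add: in_line_at_infinity)
qed

lemma inj_affine_line: "inj affine_line"
proof (rule injI)
  fix x y :: 'a
  assume "affine_line x = affine_line y"
  moreover have "vector [x, 1] \<in> affine_line x"
    unfolding affine_line_def by (rule vec.span_base) simp
  ultimately have "vector [x, 1] \<in> affine_line y"
    by simp
  then obtain c where "vector [x, 1] = c *s (vector [y, 1] :: 'a^2)"
    unfolding affine_line_def vec.span_singleton by blast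
  then show "x = y"
    using vec_eq_iff[of "vector [x, 1] :: 'a^2" "c *s vector [y, 1]"] by (simp add: forall_2)
qed

text \<open>A nonzero vector is the first column of a matrix of determinant one.\<close>

lemma projective_line_homogeneous:
  "(projective_line :: ('k::field^2) set set) = (\<lambda>A. line_act A line_at_infinity) ` carrier SL2"
proof (intro equalityI subsetI)
  fix L :: "('k^2) set"
  assume "L \<in> projective_line"
  then obtain v where v: "L = vec.span {v}" "v \<noteq> 0"
    by (auto simp: projective_line_def)
  have "\<exists>A :: 'k^2^2. det A = 1 \<and> A $ 1 $ 1 = v $ 1 \<and> A $ 2 $ 1 = v $ 2"
  proof (cases "v $ 1 = 0")
    case True
    then have "v $ 2 \<noteq> 0"
      using v(2) by (simp add: vec_eq_iff forall_2)
    then show ?thesis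
      using True
      by (intro exI[of _ "vector [vector [0, - inverse (v $ 2)], vector [v $ 2, 0]]"])
        (simp add: det_2)
  next
    case False
    then show ?thesis
      by (intro exI[of _ "vector [vector [v $ 1, 0], vector [v $ 2, inverse (v $ 1)]]"])
        (simp add: det_2)
  qed
  then obtain A :: "'k^2^2" where A: "det A = 1" "A $ 1 $ 1 = v $ 1" "A $ 2 $ 1 = v $ 2"
    by blast
  have "vector [v $ 1, v $ 2] = v"
    by (simp add: vec_eq_iff forall_2)
  then have "L = line_act A line_at_infinity"
    by (simp add: line_act_infinity A v)
  then show "L \<in> (\<lambda>A. line_act A line_at_infinity) ` carrier SL2"
    using A(1) by (auto simp: carrier_SL2)
next
  fix L :: "('k^2) set"
  assume "L \<in> (\<lambda>A. line_act A line_at_infinity) ` carrier SL2"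
  then obtain A :: "'k^2^2" where A: "det A = 1" "L = line_act A line_at_infinity"
    by (auto simp: carrier_SL2)
  have "vector [A $ 1 $ 1, A $ 2 $ 1] \<noteq> (0 :: 'k^2)"
  proof
    assume "vector [A $ 1 $ 1, A $ 2 $ 1] = (0 :: 'k^2)"
    then have "A $ 1 $ 1 = 0" "A $ 2 $ 1 = 0"
      by (simp_all add: vec_eq_iff forall_2)
    then show False
      using A(1) by (simp add: det_2)
  qed
  then show "L \<in> projective_line"
    unfolding A(2) line_act_infinity projective_line_def by blast
qed

lemma projective_line_eq:
  assumes "(1::'k::field) + 1 = 0"
  shows "(projective_line :: ('k^2) set set) = insert line_at_infinity (range affine_line)"
proof (intro equalityI subsetI)
  fix L :: "('k^2) set"
  assume "L \<in> projective_line"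
  then obtain A :: "'k^2^2" where A: "det A = 1" "L = line_act A line_at_infinity"
    by (auto simp: projective_line_homogeneous carrier_SL2)
  show "L \<in> insert line_at_infinity (range affine_line)"
    using assms A(1)
  proof (cases rule: bruhat)
    case (borel a y)
    then show ?thesis
      by (simp add: A(2) line_act_mult line_act_unip line_act_torus)
  next
    case (big_cell x a y)
    then have "L = line_act (unip x ** weyl) line_at_infinity"
      by (simp add: A(2) line_act_mult line_act_unip line_act_torus)
    then show ?thesis
      by (simp add: line_act_unip_weyl)
  qed
next
  fix L :: "('k^2) set"
  have "vector [1, 0] \<noteq> (0 :: 'k^2)" "vector [x, 1] \<noteq> (0 :: 'k^2)" for x
    by (simp_all add: vec_eq_iff forall_2)
  moreover assume "L \<in> insert line_at_infinity (range affine_line)"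
  ultimately show "L \<in> projective_line"
    by (auto simp: projective_line_def line_at_infinity_def affine_line_def)
qed

section \<open>Common fixed vectors and common eigenvectors\<close>

text \<open>The vector \<open>x + f b x\<close> is fixed by \<open>f b\<close>, and if it vanishes then \<open>x\<close> itself is fixed by
  \<open>f b\<close>; either vector is still fixed by everything that fixed \<open>x\<close>.\<close>

lemma commuting_involutions_fixed_vector:
  fixes K :: "'v::ab_group_add set" and f :: "'i \<Rightarrow> 'v \<Rightarrow> 'v"
  assumes fin: "finite A" and ne: "x0 \<in> K" "x0 \<noteq> 0"
    and add: "\<And>x y. x \<in> K \<Longrightarrow> y \<in> K \<Longrightarrow> x + y \<in> K"
    and double: "\<And>x. x \<in> K \<Longrightarrow> x + x = 0"
    and closed: "\<And>a x. x \<in> K \<Longrightarrow> f a x \<in> K"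
    and additive: "\<And>a x y. x \<in> K \<Longrightarrow> y \<in> K \<Longrightarrow> f a (x + y) = f a x + f a y"
    and invol: "\<And>a x. x \<in> K \<Longrightarrow> f a (f a x) = x"
    and comm: "\<And>a b x. x \<in> K \<Longrightarrow> f a (f b x) = f b (f a x)"
  shows "\<exists>x\<in>K. x \<noteq> 0 \<and> (\<forall>a\<in>A. f a x = x)"
  using fin
proof (induction A)
  case empty
  then show ?case using ne by blast
next
  case (insert b A)
  then obtain x where x: "x \<in> K" "x \<noteq> 0" "\<forall>a\<in>A. f a x = x"
    by blast
  show ?case
  proof (cases "x + f b x = 0")
    case True
    then have "f b x = x"
      using double[OF x(1)] by (metis add_left_cancel)
    then show ?thesis using x by blast
  next
    case False
    have "f b (x + f b x) = x + f b x"
      using x by (simp add: additive closed invol add.commute)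
    moreover have "f a (x + f b x) = x + f b x" if "a \<in> A" for a
      using x that by (simp add: additive closed comm[of x a b])
    ultimately show ?thesis
      using False x by (metis add closed insert_iff)
  qed
qed

text \<open>If a polynomial \<open>p\<close> in \<open>f\<close> kills a nonzero vector \<open>x\<close>, split off a root \<open>r\<close>, \<open>p = (X - r) s\<close>:
  either \<open>s\<close> evaluated at \<open>f\<close> kills \<open>x\<close>, or it maps \<open>x\<close> to an eigenvector with eigenvalue \<open>r\<close>.\<close>

lemma (in vector_space) eigenvector_of_annihilating_poly:
  fixes p :: "'a::field poly"
  assumes roots: "\<And>p :: 'a poly. Polynomial.degree p > 0 \<Longrightarrow> \<exists>r. Polynomial.poly p r = 0"
    and K: "subspace K" and closed: "\<And>x. x \<in> K \<Longrightarrow> f x \<in> K"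
    and additive: "\<And>x y. x \<in> K \<Longrightarrow> y \<in> K \<Longrightarrow> f (x + y) = f x + f y"
    and scale: "\<And>c x. x \<in> K \<Longrightarrow> f (scale c x) = scale c (f x)"
    and x: "x \<in> K" "x \<noteq> 0"
    and p: "p \<noteq> 0" "Polynomial.degree p \<le> N" "(\<Sum>i\<le>N. scale (Polynomial.coeff p i) ((f ^^ i) x)) = 0"
  shows "\<exists>y\<in>K. y \<noteq> 0 \<and> (\<exists>c. f y = scale c y)"
  using p
proof (induction N arbitrary: p)
  case 0
  then have "Polynomial.coeff p 0 = 0"
    using x by simp
  then show ?case
    using 0 by (metis le_zero_eq leading_coeff_0_iff)
next
  case (Suc N)
  have pow: "(f ^^ i) x \<in> K" for i
    by (induction i) (auto simp: x closed)
  have f_sum: "f (\<Sum>i\<le>M. scale (b i) ((f ^^ i) x)) = (\<Sum>i\<le>M. scale (b i) ((f ^^ Suc i) x))"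
    for b M
    by (induction M)
      (simp_all add: additive scale pow subspace_sum K subspace_scale closed x)
  show ?case
  proof (cases "Polynomial.degree p = 0")
    case True
    then obtain c where "p = [:c:]"
      by (metis degree_eq_zeroE)
    then have "(\<Sum>i\<le>Suc N. scale (Polynomial.coeff p i) ((f ^^ i) x)) =
        (\<Sum>i\<le>Suc N. if i = 0 then scale c x else 0)"
      by (intro sum.cong) (auto simp: coeff_pCons split: nat.split)
    also have "\<dots> = scale c x"
      by simp
    finally have "(\<Sum>i\<le>Suc N. scale (Polynomial.coeff p i) ((f ^^ i) x)) = scale c x" .
    then show ?thesis
      using Suc.prems \<open>p = [:c:]\<close> x by simp
  next
    case False
    then obtain r where "Polynomial.poly p r = 0"
      using roots by blast
    then obtain s where s: "p = [:- r, 1:] * s"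
      by (metis dvdE poly_eq_0_iff_dvd)
    have s0: "s \<noteq> 0"
      using Suc.prems s by auto
    have "Polynomial.degree p = Suc (Polynomial.degree s)"
      unfolding s by (subst Polynomial.degree_mult_eq) (use s0 in auto)
    then have deg: "Polynomial.degree s \<le> N"
      using Suc.prems by simp
    let ?y = "\<Sum>i\<le>N. scale (Polynomial.coeff s i) ((f ^^ i) x)"
    have c0: "Polynomial.coeff s (Suc N) = 0"
      using deg by (simp add: coeff_eq_0)
    have "0 = (\<Sum>i\<le>Suc N. scale (Polynomial.coeff p i) ((f ^^ i) x))"
      using Suc.prems by simp
    also have "\<dots> = (\<Sum>i\<le>Suc N. scale (Polynomial.coeff (pCons 0 s) i) ((f ^^ i) x)
        - scale r (scale (Polynomial.coeff s i) ((f ^^ i) x)))"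
      by (rule sum.cong) (auto simp: s scale_left_diff_distrib)
    also have "\<dots> = (\<Sum>i\<le>Suc N. scale (Polynomial.coeff (pCons 0 s) i) ((f ^^ i) x))
        - scale r (\<Sum>i\<le>Suc N. scale (Polynomial.coeff s i) ((f ^^ i) x))"
      by (simp only: sum_subtractf scale_sum_right)
    also have "(\<Sum>i\<le>Suc N. scale (Polynomial.coeff (pCons 0 s) i) ((f ^^ i) x)) = f ?y"
      unfolding f_sum by (subst sum.atMost_Suc_shift) simp
    also have "(\<Sum>i\<le>Suc N. scale (Polynomial.coeff s i) ((f ^^ i) x)) = ?y"
      by (simp add: c0)
    finally have "f ?y = scale r ?y"
      by simp
    moreover have "?y \<in> K"
      by (intro subspace_sum subspace_scale K pow)
    ultimately show ?thesis
      using Suc.IH[OF s0 deg] by blast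
  qed
qed

text \<open>Each operator stabilises the joint eigenspaces of the others, so the common eigenvectors can
  be found one operator at a time.\<close>

lemma commuting_finite_order_common_eigenvector:
  fixes smul :: "'a::alg_closed_field \<Rightarrow> 'v::ab_group_add \<Rightarrow> 'v" and f :: "'i \<Rightarrow> 'v \<Rightarrow> 'v"
  assumes vs: "vector_space smul" and fin: "finite A" and K: "module.subspace smul K"
    and ne: "x0 \<in> K" "x0 \<noteq> 0"
    and closed: "\<And>a x. a \<in> A \<Longrightarrow> x \<in> K \<Longrightarrow> f a x \<in> K"
    and additive: "\<And>a x y. a \<in> A \<Longrightarrow> x \<in> K \<Longrightarrow> y \<in> K \<Longrightarrow> f a (x + y) = f a x + f a y"
    and scale: "\<And>a c x. a \<in> A \<Longrightarrow> x \<in> K \<Longrightarrow> f a (smul c x) = smul c (f a x)"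
    and comm: "\<And>a b x. a \<in> A \<Longrightarrow> b \<in> A \<Longrightarrow> x \<in> K \<Longrightarrow> f a (f b x) = f b (f a x)"
    and order: "m > 0" "\<And>a x. a \<in> A \<Longrightarrow> x \<in> K \<Longrightarrow> (f a ^^ m) x = x"
  shows "\<exists>x\<in>K. x \<noteq> 0 \<and> (\<exists>c. \<forall>a\<in>A. f a x = smul (c a) x)"
proof -
  interpret vector_space smul by (rule vs)
  have "\<exists>x\<in>K. x \<noteq> 0 \<and> (\<exists>c. \<forall>a\<in>A'. f a x = smul (c a) x)" if "finite A'" "A' \<subseteq> A" for A'
    using that
  proof (induction A')
    case empty
    then show ?case using ne by blast
  next
    case (insert b A')
    then have "\<exists>x\<in>K. x \<noteq> 0 \<and> (\<exists>c. \<forall>a\<in>A'. f a x = smul (c a) x)" and b: "b \<in> A"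
      by simp_all
    then obtain x c where x: "x \<in> K" "x \<noteq> 0" "\<forall>a\<in>A'. f a x = smul (c a) x"
      by (elim bexE conjE exE)
    define E where "E = {y \<in> K. \<forall>a\<in>A'. f a y = smul (c a) y}"
    have sub: "a \<in> A" if "a \<in> A'" for a
      using that insert by blast
    have f0: "f a 0 = 0" if "a \<in> A" for a
      using additive[OF that subspace_0[OF K] subspace_0[OF K]] by simp
    have E: "subspace E"
    proof (rule subspaceI)
      show "0 \<in> E"
        by (simp add: E_def f0 sub subspace_0[OF K])
      show "y + z \<in> E" if "y \<in> E" "z \<in> E" for y z
        using that by (simp add: E_def subspace_add[OF K] additive sub scale_right_distrib)
      show "smul d y \<in> E" if "y \<in> E" for d y
        using that by (simp add: E_def subspace_scale[OF K] scale sub mult.commute)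
    qed
    let ?p = "Polynomial.monom 1 m - 1 :: 'a poly"
    have "Polynomial.coeff ?p m = 1"
      using order(1) by simp
    then have p0: "?p \<noteq> 0"
      by (metis Polynomial.coeff_0 zero_neq_one)
    have deg: "Polynomial.degree ?p \<le> m"
      by (rule degree_diff_le) (simp_all add: Polynomial.degree_monom_le)
    have "(\<Sum>i\<le>m. smul (Polynomial.coeff ?p i) ((f b ^^ i) x)) =
        (\<Sum>i\<le>m. (if i = m then (f b ^^ i) x else 0) - (if i = 0 then (f b ^^ i) x else 0))"
      using order(1) by (intro sum.cong) auto
    also have "\<dots> = 0"
      using order(2)[OF b x(1)] by (simp add: sum_subtractf sum.delta)
    finally have ann: "(\<Sum>i\<le>m. smul (Polynomial.coeff ?p i) ((f b ^^ i) x)) = 0" .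
    have "\<exists>y\<in>E. y \<noteq> 0 \<and> (\<exists>d. f b y = smul d y)"
    proof (rule eigenvector_of_annihilating_poly[OF _ E _ _ _ _ x(2) p0 deg ann])
      show "f b y \<in> E" if "y \<in> E" for y
      proof -
        have y: "y \<in> K" "\<And>a. a \<in> A' \<Longrightarrow> f a y = smul (c a) y"
          using that by (simp_all add: E_def)
        have "f a (f b y) = smul (c a) (f b y)" if "a \<in> A'" for a
          unfolding comm[OF sub[OF that] b y(1)] y(2)[OF that] by (rule scale[OF b y(1)])
        then show ?thesis
          using closed[OF b y(1)] by (simp add: E_def)
      qed
      show "x \<in> E"
        using x by (simp add: E_def)
    qed (simp_all add: E_def additive[OF b] scale[OF b] alg_closed_imp_poly_has_root)
    then obtain y d where y: "y \<in> E" "y \<noteq> 0" "f b y = smul d y"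
      by blast
    have "\<forall>a\<in>insert b A'. f a y = smul ((c(b := d)) a) y"
      using y insert(2) by (simp add: E_def)
    moreover have "y \<in> K"
      using y by (simp add: E_def)
    ultimately show ?case
      using y(2) by (intro bexI[of _ y] conjI exI[of _ "c(b := d)"])
  qed
  from this[OF fin subset_refl] show ?thesis .
qed

section \<open>Traces\<close>

context linear_rep
begin

lemma finite_basis:
  assumes "basis_of smul V B"
  shows "finite B"
proof -
  obtain C where "finite C" "V \<subseteq> span C"
    using finite_dim by blast
  moreover have "independent B" "B \<subseteq> V"
    using assms span_superset[of B] by (simp_all add: basis_of_def)
  ultimately show ?thesis
    using independent_span_bound[of C B] by (simp add: subset_trans)
qed

lemma exists_basis: "\<exists>B. basis_of smul V B"
proof -
  obtain B where B: "B \<subseteq> V" "independent B" "V \<subseteq> span B" "card B = dim V"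
    by (rule basis_exists)
  have "basis_of smul V B"
    using span_subspace[OF B(1) B(3) subspace] B(2) by (simp add: basis_of_def)
  then show ?thesis ..
qed

lemma trace_basis:
  obtains B where "independent B" "span B = V" "finite B"
    "\<And>T. endo_trace smul V T = (\<Sum>b\<in>B. representation B (T b) b)"
proof -
  let ?B = "SOME B. basis_of smul V B"
  have B: "basis_of smul V ?B"
    using exists_basis by (rule someI_ex)
  show ?thesis
  proof (rule that)
    show "independent ?B" "span ?B = V"
      using B unfolding basis_of_def by (rule conjunct1, rule conjunct2)
    show "finite ?B"
      using B by (rule finite_basis)
    show "endo_trace smul V T = (\<Sum>b\<in>?B. representation ?B (T b) b)" for T
      unfolding endo_trace_def Let_def ..
  qed
qed

lemma endo_trace_linear_combination:
  assumes T: "\<And>i x. i \<in> I \<Longrightarrow> x \<in> V \<Longrightarrow> T i x \<in> V"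
    and S: "\<And>x. x \<in> V \<Longrightarrow> S x = (\<Sum>i\<in>I. smul (c i) (T i x))"
  shows "endo_trace smul V S = (\<Sum>i\<in>I. c i * endo_trace smul V (T i))"
proof -
  obtain B where B: "independent B" "span B = V" "finite B"
    and tr: "\<And>T. endo_trace smul V T = (\<Sum>b\<in>B. representation B (T b) b)"
    by (rule trace_basis, rule that)
  have "representation B (S b) b = (\<Sum>i\<in>I. c i * representation B (T i b) b)" if "b \<in> B" for b
  proof -
    have b: "b \<in> V"
      using that B(2) span_base by blast
    have "T i b \<in> span B" "smul (c i) (T i b) \<in> span B" if "i \<in> I" for i
      using T[OF that b] by (simp_all add: B(2) subspace_scale[OF subspace])
    then show ?thesis
      by (simp add: S[OF b] representation_sum[OF B(1)] representation_scale[OF B(1)])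
  qed
  then have "endo_trace smul V S = (\<Sum>b\<in>B. \<Sum>i\<in>I. c i * representation B (T i b) b)"
    unfolding tr by (intro sum.cong) auto
  then show ?thesis
    unfolding tr sum_distrib_left by (subst sum.swap)
qed

text \<open>The operator maps \<open>v\<close> to \<open>l v\<close> times itself; the trace is computed in an arbitrary basis, by
  expanding \<open>v\<close> in it.\<close>

lemma endo_trace_rank_one:
  assumes v: "v \<in> V"
    and additive: "\<And>x y. x \<in> V \<Longrightarrow> y \<in> V \<Longrightarrow> l (x + y) = l x + l y"
    and homogeneous: "\<And>c x. x \<in> V \<Longrightarrow> l (smul c x) = c * l x"
    and S: "\<And>x. x \<in> V \<Longrightarrow> S x = smul (l x) v"
  shows "endo_trace smul V S = l v"
proof -
  obtain B where B: "independent B" "span B = V" "finite B"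
    and tr: "\<And>T. endo_trace smul V T = (\<Sum>b\<in>B. representation B (T b) b)"
    by (rule trace_basis, rule that)
  have b: "b \<in> V" if "b \<in> B" for b
    using that B(2) span_base by blast
  have l0: "l 0 = 0"
    using homogeneous[of 0 0] subspace_0[OF subspace] by simp
  have mem: "(\<Sum>b\<in>A. smul (c b) b) \<in> V" if "A \<subseteq> B" for A c
    using that b by (intro subspace_sum[OF subspace] subspace_scale[OF subspace]) auto
  have l_sum: "l (\<Sum>b\<in>A. smul (c b) b) = (\<Sum>b\<in>A. c b * l b)" if "A \<subseteq> B" for A c
    using finite_subset[OF that B(3)] that
    by (induction A rule: finite_induct)
      (auto simp: l0 additive homogeneous b mem subspace_scale[OF subspace])
  have "endo_trace smul V S = (\<Sum>b\<in>B. representation B v b * l b)"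
    unfolding tr using v B(2) b by (intro sum.cong) (auto simp: S representation_scale B(1))
  also have "\<dots> = l (\<Sum>b\<in>B. smul (representation B v b) b)"
    by (simp add: l_sum)
  also have "(\<Sum>b\<in>B. smul (representation B v b) b) = v"
    using v B by (intro sum_representation_eq) auto
  finally show ?thesis .
qed

end

section \<open>Absolute irreducibility over an algebraically closed field\<close>

text \<open>An algebraically closed field has no proper algebraic extension: an element of the closure is
  a root of a product of linear factors over the base field.\<close>

lemma surj_to_ac: "surj (to_ac :: 'a::alg_closed_field \<Rightarrow> 'a alg_closure)"
proof (rule surjI)
  fix x :: "'a alg_closure"
  obtain p :: "'a poly" where p: "p \<noteq> 0" "Polynomial.poly (map_poly to_ac p) x = 0"
    by (rule alg_closure_algebraic)
  obtain A c where p_eq: "p = Polynomial.smult c (\<Prod>r\<in>#A. [:- r, 1:])"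
    using alg_closed_imp_factorization[OF p(1)] by blast
  have map_mult: "map_poly to_ac (p * q) = map_poly to_ac p * map_poly to_ac q" for p q :: "'a poly"
    by (rule poly_eqI) (simp add: coeff_map_poly Polynomial.coeff_mult to_ac_sum)
  have "Polynomial.poly (map_poly to_ac (\<Prod>r\<in>#A. [:- r, 1:])) x = (\<Prod>r\<in>#A. x - to_ac r)"
    by (induction A)
      (simp_all add: map_mult map_poly_pCons image_mset_add_mset prod_mset.add_mset
        del: mult_pCons_left)
  moreover have "Polynomial.poly (map_poly to_ac p) x =
      to_ac c * Polynomial.poly (map_poly to_ac (\<Prod>r\<in>#A. [:- r, 1:])) x"
    unfolding p_eq by (simp add: map_poly_smult)
  moreover have "c \<noteq> 0"
    using p(1) p_eq by auto
  ultimately have "(\<Prod>r\<in>#A. x - to_ac r) = 0"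
    using p(2) by simp
  then obtain r where "x = to_ac r"
    by (auto simp: prod_mset_zero_iff)
  then show "to_ac (of_ac x) = x"
    by simp
qed

text \<open>The extension of scalars is taken along a bijective homomorphism, so taking coordinates with
  respect to the basis identifies \<open>V\<close> semilinearly with the extended space, and an invariant
  subspace of \<open>V\<close> is mapped to an invariant subspace.\<close>

lemma absolutely_irreducible_imp_irreducible:
  fixes smul :: "'F::alg_closed_field \<Rightarrow> 'v::ab_group_add \<Rightarrow> 'v"
  assumes "absolutely_irreducible_rep smul G V \<rho>"
  shows "irreducible_rep smul G V \<rho>"
proof -
  obtain B where rep: "linear_rep smul G V \<rho>" and basis: "basis_of smul V B"
    and irr: "irreducible_rep fun_scale G (ext_space B :: ('v \<Rightarrow> 'F alg_closure) set)
      (ext_action to_ac smul B \<rho>)"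
    using assms by (auto simp: absolutely_irreducible_rep_def)
  interpret linear_rep smul G V \<rho> by (rule rep)
  have B: "independent B" "span B = V" "finite B"
    using basis finite_basis[OF basis] by (simp_all add: basis_of_def)
  interpret E: linear_rep fun_scale G "ext_space B :: ('v \<Rightarrow> 'F alg_closure) set"
      "ext_action to_ac smul B \<rho>"
    using irr by (simp add: irreducible_rep_def)
  define \<phi> :: "'v \<Rightarrow> 'v \<Rightarrow> 'F alg_closure" where "\<phi> w b = to_ac (representation B w b)" for w b
  have rep_outside: "representation B w b = 0" if "b \<notin> B" for w b
    using that representation_ne_zero by blast
  have rep_sum: "(\<Sum>b\<in>B. smul (representation B w b) b) = w" if "w \<in> V" for w
    using that B by (intro sum_representation_eq) auto
  have closed: "\<rho> g w \<in> V" if "g \<in> carrier G" "w \<in> V" for g w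
    using element_image[OF that(1,2)] by simp
  have \<phi>_ext: "\<phi> w \<in> ext_space B" for w
    by (simp add: ext_space_def \<phi>_def rep_outside)
  have \<phi>_add: "\<phi> (w + w') = \<phi> w + \<phi> w'" if "w \<in> V" "w' \<in> V" for w w'
    using that B by (auto simp: \<phi>_def representation_add)
  have \<phi>_scale: "\<phi> (smul c w) = fun_scale (to_ac c) (\<phi> w)" if "w \<in> V" for c w
    using that B by (auto simp: \<phi>_def representation_scale fun_scale_def)
  have \<phi>_0: "\<phi> 0 = 0"
    by (auto simp: \<phi>_def representation_zero)
  have \<phi>_inj: "w = w'" if "\<phi> w = \<phi> w'" "w \<in> V" "w' \<in> V" for w w'
  proof -
    have "representation B w b = representation B w' b" for b
      using fun_cong[OF that(1), of b] by (simp add: \<phi>_def)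
    then have "(\<Sum>b\<in>B. smul (representation B w b) b) = (\<Sum>b\<in>B. smul (representation B w' b) b)"
      by simp
    then show ?thesis
      unfolding rep_sum[OF that(2)] rep_sum[OF that(3)] .
  qed
  have \<phi>_action: "ext_action to_ac smul B \<rho> g (\<phi> w) = \<phi> (\<rho> g w)"
    if g: "g \<in> carrier G" and w: "w \<in> V" for g w
  proof
    fix b'
    have b: "b \<in> V" if "b \<in> B" for b
      using that B(2) span_base by blast
    have "\<rho> g (\<Sum>b\<in>A. smul (representation B w b) b) = (\<Sum>b\<in>A. smul (representation B w b) (\<rho> g b))"
      if "A \<subseteq> B" for A
      using finite_subset[OF that B(3)] that
    proof (induction A rule: finite_induct)
      case empty
      show ?case
        using rho_scale[OF g subspace_0[OF subspace], of 0] by simp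
    next
      case (insert b A)
      then have "b \<in> V" "(\<Sum>b\<in>A. smul (representation B w b) b) \<in> V"
        using b by (auto intro!: subspace_sum[OF subspace] subspace_scale[OF subspace])
      then show ?case
        using insert g by (simp add: rho_add rho_scale subspace_scale[OF subspace])
    qed
    from this[OF subset_refl] have "\<rho> g w = (\<Sum>b\<in>B. smul (representation B w b) (\<rho> g b))"
      by (simp add: rep_sum[OF w])
    moreover have "smul (representation B w b) (\<rho> g b) \<in> span B" "\<rho> g b \<in> span B" if "b \<in> B" for b
      using closed[OF g b[OF that]] by (simp_all add: B(2) subspace_scale[OF subspace])
    ultimately have "representation B (\<rho> g w) b' =
        (\<Sum>b\<in>B. representation B w b * representation B (\<rho> g b) b')"
      by (simp add: representation_sum[OF B(1)] representation_scale[OF B(1)])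
    then show "ext_action to_ac smul B \<rho> g (\<phi> w) b' = \<phi> (\<rho> g w) b'"
      by (simp add: ext_action_def \<phi>_ext) (simp add: \<phi>_def to_ac_sum mult.commute)
  qed
  have W: "W = {0} \<or> W = V" if "invariant_subspace smul G V \<rho> W" for W
  proof -
    have W: "subspace W" "W \<subseteq> V" "\<And>g w. g \<in> carrier G \<Longrightarrow> w \<in> W \<Longrightarrow> \<rho> g w \<in> W"
      using that by (simp_all add: invariant_subspace_def)
    have mem: "w \<in> V" if "w \<in> W" for w
      using W(2) that by (rule subsetD)
    have "invariant_subspace fun_scale G (ext_space B) (ext_action to_ac smul B \<rho>) (\<phi> ` W)"
      unfolding invariant_subspace_def
    proof (intro conjI ballI)
      show "E.subspace (\<phi> ` W)"
      proof (rule E.subspaceI)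
        show "0 \<in> \<phi> ` W"
          using imageI[OF subspace_0[OF W(1)], of \<phi>] by (simp add: \<phi>_0)
        show "x + y \<in> \<phi> ` W" if "x \<in> \<phi> ` W" "y \<in> \<phi> ` W" for x y
        proof -
          obtain w w' where w: "w \<in> W" "w' \<in> W" "x = \<phi> w" "y = \<phi> w'"
            using \<open>x \<in> \<phi> ` W\<close> \<open>y \<in> \<phi> ` W\<close> by blast
          have "x + y = \<phi> (w + w')"
            using w by (simp add: \<phi>_add mem)
          then show ?thesis
            using subspace_add[OF W(1) w(1,2)] by (rule image_eqI)
        qed
        show "fun_scale c x \<in> \<phi> ` W" if "x \<in> \<phi> ` W" for c x
        proof -
          obtain w where w: "w \<in> W" "x = \<phi> w"
            using \<open>x \<in> \<phi> ` W\<close> by blast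
          obtain d where d: "c = to_ac d"
            using surj_to_ac by (rule surjE)
          have "fun_scale c x = \<phi> (smul d w)"
            using w d by (simp add: \<phi>_scale mem)
          then show ?thesis
            using subspace_scale[OF W(1) w(1)] by (rule image_eqI)
        qed
      qed
      show "\<phi> ` W \<subseteq> ext_space B"
        using \<phi>_ext by blast
      show "ext_action to_ac smul B \<rho> g x \<in> \<phi> ` W" if "g \<in> carrier G" "x \<in> \<phi> ` W" for g x
      proof -
        obtain w where w: "w \<in> W" "x = \<phi> w"
          using \<open>x \<in> \<phi> ` W\<close> by blast
        have "ext_action to_ac smul B \<rho> g x = \<phi> (\<rho> g w)"
          using w \<open>g \<in> carrier G\<close> by (simp add: \<phi>_action mem)
        then show ?thesis
          using W(3)[OF \<open>g \<in> carrier G\<close> w(1)] by (rule image_eqI)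
      qed
    qed
    then consider "\<phi> ` W = {0}" | "\<phi> ` W = ext_space B"
      using irr unfolding irreducible_rep_def by blast
    then show ?thesis
    proof cases
      case 1
      have "w = 0" if "w \<in> W" for w
      proof (rule \<phi>_inj)
        show "\<phi> w = \<phi> 0"
          using imageI[OF that, of \<phi>] unfolding 1 \<phi>_0 by simp
        show "w \<in> V"
          using that by (rule mem)
        show "0 \<in> V"
          by (rule subspace_0[OF subspace])
      qed
      with subspace_0[OF W(1)] have "W = {0}" by blast
      then show ?thesis ..
    next
      case 2
      have "w \<in> W" if "w \<in> V" for w
      proof -
        have "\<phi> w \<in> \<phi> ` W"
          unfolding 2 by (rule \<phi>_ext)
        then obtain w' where w': "w' \<in> W" "\<phi> w = \<phi> w'"
          by (rule imageE)
        have "w = w'"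
          using w'(2) that mem[OF w'(1)] by (rule \<phi>_inj)
        with w'(1) show ?thesis
          by (simp only:)
      qed
      then have "V \<subseteq> W"
        by (rule subsetI)
      with W(2) have "W = V"
        by (rule subset_antisym)
      then show ?thesis ..
    qed
  qed
  have "V \<noteq> {0}"
  proof
    assume V: "V = {0}"
    have "B = {}"
    proof (rule ccontr)
      assume "B \<noteq> {}"
      then obtain b where b: "b \<in> B" by blast
      then have "b \<in> V"
        using B(2) span_base by blast
      then show False
        using V b B(1) dependent_zero[of B] by simp
    qed
    then have "(ext_space B :: ('v \<Rightarrow> 'F alg_closure) set) = {0}"
      by (auto simp: ext_space_def zero_fun_def)
    then show False
      using irr by (simp add: irreducible_rep_def)
  qed
  then show ?thesis
    unfolding irreducible_rep_def using rep W by (intro conjI allI impI)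
qed

section \<open>Operators of the unipotent subgroup\<close>

locale char2_SL2_rep = linear_rep smul SL2 V \<rho>
  for smul :: "'F::alg_closed_field \<Rightarrow> 'v::ab_group_add \<Rightarrow> 'v"
    and V :: "'v set" and \<rho> :: "'k::{field,finite}^2^2 \<Rightarrow> 'v \<Rightarrow> 'v" +
  assumes char_F: "(1::'F) + 1 = 0" and char_k: "(1::'k) + 1 = 0" and even_card: "even CARD('k)"
    and nonzero: "V \<noteq> {0}"
    and irreducible: "invariant_subspace smul SL2 V \<rho> W \<Longrightarrow> W = {0} \<or> W = V"
begin

lemma carriers: "unip x \<in> carrier SL2" "a \<noteq> 0 \<Longrightarrow> torus a \<in> carrier SL2"
    "(weyl :: 'k^2^2) \<in> carrier SL2" "(mat 1 :: 'k^2^2) \<in> carrier SL2"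
    "g \<in> carrier SL2 \<Longrightarrow> h \<in> carrier SL2 \<Longrightarrow> g ** h \<in> carrier SL2"
  by (simp_all add: carrier_SL2 det_unip det_torus det_weyl[OF char_k] det_mul)

lemma rho_closed: "g \<in> carrier SL2 \<Longrightarrow> x \<in> V \<Longrightarrow> \<rho> g x \<in> V"
  using element_image by blast

lemma rho_mult:
  "g \<in> carrier SL2 \<Longrightarrow> h \<in> carrier SL2 \<Longrightarrow> x \<in> V \<Longrightarrow> \<rho> (g ** h) x = \<rho> g (\<rho> h x)"
  using composition_rule[of x g h] by (simp add: mult_SL2)

lemma rho_one: "x \<in> V \<Longrightarrow> \<rho> (mat 1) x = x"
  using fun_cong[OF id_eq_one, of x] by (simp add: one_SL2)

lemma rho_zero: "g \<in> carrier SL2 \<Longrightarrow> \<rho> g 0 = 0"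
  using rho_add[of g 0 0] subspace_0[OF subspace] by simp

lemma rho_sum:
  "g \<in> carrier SL2 \<Longrightarrow> (\<And>i. i \<in> I \<Longrightarrow> f i \<in> V) \<Longrightarrow> \<rho> g (\<Sum>i\<in>I. f i) = (\<Sum>i\<in>I. \<rho> g (f i))"
  by (induction I rule: infinite_finite_induct)
    (auto simp: rho_zero rho_add subspace_sum[OF subspace])

lemmas mem_simps = carriers rho_closed subspace_0[OF subspace] subspace_add[OF subspace]
  subspace_scale[OF subspace] subspace_sum[OF subspace] subspace_neg[OF subspace]
  subspace_diff[OF subspace]

lemma double_F: "(c::'F) + c = 0"
  by (rule double_eq_0[OF char_F])

lemma double_V: "(x::'v) + x = 0"
  by (metis char_F scale_left_distrib scale_one scale_zero_left)

lemma neg_V: "- (x::'v) = x"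
  by (rule minus_unique[OF double_V])

lemma card_F: "of_nat CARD('k) = (0::'F)"
  using even_card char_F by (auto elim!: evenE)

lemma unip_unip: "x \<in> V \<Longrightarrow> \<rho> (unip a) (\<rho> (unip b) x) = \<rho> (unip (a + b)) x"
  by (simp flip: rho_mult add: mem_simps unip_mult)

lemma torus_torus:
  "a \<noteq> 0 \<Longrightarrow> b \<noteq> 0 \<Longrightarrow> x \<in> V \<Longrightarrow> \<rho> (torus a) (\<rho> (torus b) x) = \<rho> (torus (a * b)) x"
  by (simp flip: rho_mult add: mem_simps torus_mult)

lemma torus_unip_act:
  "a \<noteq> 0 \<Longrightarrow> x \<in> V \<Longrightarrow> \<rho> (torus a) (\<rho> (unip b) x) = \<rho> (unip (a\<^sup>2 * b)) (\<rho> (torus a) x)"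
  by (simp flip: rho_mult add: mem_simps torus_unip)

lemma torus_weyl_act:
  "a \<noteq> 0 \<Longrightarrow> x \<in> V \<Longrightarrow> \<rho> (torus a) (\<rho> weyl x) = \<rho> weyl (\<rho> (torus (inverse a)) x)"
  by (simp flip: rho_mult add: mem_simps torus_weyl)

lemma weyl_weyl_act: "x \<in> V \<Longrightarrow> \<rho> weyl (\<rho> weyl x) = x"
  by (simp flip: rho_mult add: mem_simps weyl_weyl rho_one)

text \<open>The span of the orbit of \<open>x\<close> is an invariant subspace, hence all of \<open>V\<close>; this is the form in
  which irreducibility is used.\<close>

lemma vectors_in_span_of_orbit:
  assumes x: "x \<in> V" "x \<noteq> 0" and W: "subspace W" "\<And>g. g \<in> carrier SL2 \<Longrightarrow> \<rho> g x \<in> W"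
  shows "V \<subseteq> W"
proof -
  let ?O = "(\<lambda>g. \<rho> g x) ` carrier SL2"
  have V: "span ?O \<subseteq> V"
    by (rule span_minimal) (auto simp: subspace rho_closed x)
  have "w \<in> V \<and> \<rho> g w \<in> span ?O" if g: "g \<in> carrier SL2" and w: "w \<in> span ?O" for g w
    using w
  proof (induction rule: span_induct_alt)
    case base
    then show ?case by (simp add: rho_zero g span_zero mem_simps)
  next
    case (step c y z)
    then obtain h where h: "h \<in> carrier SL2" "y = \<rho> h x" by blast
    have "\<rho> g y = \<rho> (g ** h) x"
      using h g x by (simp add: rho_mult)
    then have "\<rho> g y \<in> span ?O"
      using h g by (intro span_base) (auto simp: mem_simps)
    moreover have "y \<in> V"
      using h x by (simp add: mem_simps)
    ultimately show ?case
      using step(2) g by (simp add: rho_add rho_scale mem_simps span_add span_scale)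
  qed
  then have "invariant_subspace smul SL2 V \<rho> (span ?O)"
    using V by (auto simp: invariant_subspace_def)
  moreover have "x \<in> span ?O"
    using x rho_one[of x] by (intro span_base image_eqI[of _ _ "mat 1"]) (auto simp: carrier_SL2)
  ultimately have "span ?O = V"
    using irreducible x by blast
  moreover have "span ?O \<subseteq> W"
    using W by (intro span_minimal) auto
  ultimately show ?thesis by simp
qed

text \<open>Elements of the group algebra of the unipotent subgroup are represented by their coefficient
  functions.\<close>

definition unip_comb :: "('k \<Rightarrow> 'F) \<Rightarrow> 'v \<Rightarrow> 'v"
  where "unip_comb c x = (\<Sum>a\<in>UNIV. smul (c a) (\<rho> (unip a) x))"

lemma unip_comb_closed: "x \<in> V \<Longrightarrow> unip_comb c x \<in> V"
  by (simp add: unip_comb_def mem_simps)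

lemma unip_comb_add: "x \<in> V \<Longrightarrow> y \<in> V \<Longrightarrow> unip_comb c (x + y) = unip_comb c x + unip_comb c y"
  by (simp add: unip_comb_def rho_add mem_simps scale_right_distrib sum.distrib)

lemma unip_comb_scale: "x \<in> V \<Longrightarrow> unip_comb c (smul d x) = smul d (unip_comb c x)"
  by (simp add: unip_comb_def rho_scale mem_simps scale_sum_right mult.commute)

lemma unip_comb_zero: "unip_comb c 0 = 0"
  by (simp add: unip_comb_def rho_zero mem_simps)

lemma add_unip_comb: "unip_comb c x + unip_comb d x = unip_comb (\<lambda>a. c a + d a) x"
  by (simp add: unip_comb_def scale_left_distrib sum.distrib)

lemma scale_unip_comb: "smul d (unip_comb c x) = unip_comb (\<lambda>a. d * c a) x"
  by (simp add: unip_comb_def scale_sum_right)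

lemma unip_comb_comp:
  "x \<in> V \<Longrightarrow> unip_comb c (unip_comb d x) =
    (\<Sum>a\<in>UNIV. \<Sum>b\<in>UNIV. smul (c a * d b) (\<rho> (unip (a + b)) x))"
  by (simp add: unip_comb_def rho_sum rho_scale mem_simps unip_unip scale_sum_right)

lemma unip_comb_commute: "x \<in> V \<Longrightarrow> unip_comb c (unip_comb d x) = unip_comb d (unip_comb c x)"
  unfolding unip_comb_comp by (subst sum.swap) (simp add: add.commute mult.commute)

lemma unip_act_comb: "x \<in> V \<Longrightarrow> \<rho> (unip b) (unip_comb c x) = unip_comb (\<lambda>a. c (a - b)) x"
  unfolding unip_comb_def
  by (subst rho_sum, simp add: mem_simps, simp add: mem_simps,
      rule sum.reindex_bij_witness[of _ "\<lambda>a. a - b" "\<lambda>a. a + b"])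
    (auto simp: rho_scale mem_simps unip_unip add.commute)

lemma torus_act_comb:
  "a \<noteq> 0 \<Longrightarrow> x \<in> V \<Longrightarrow>
    \<rho> (torus a) (unip_comb c x) = unip_comb (\<lambda>b. c (b / a\<^sup>2)) (\<rho> (torus a) x)"
  unfolding unip_comb_def
  by (subst rho_sum, simp add: mem_simps, simp add: mem_simps,
      rule sum.reindex_bij_witness[of _ "\<lambda>b. b / a\<^sup>2" "\<lambda>b. a\<^sup>2 * b"])
    (auto simp: rho_scale mem_simps torus_unip_act)

lemma sum_symmetric_eq_diagonal:
  fixes f :: "'k \<Rightarrow> 'k \<Rightarrow> 'v"
  assumes "finite A" and sym: "\<And>a b. f a b = f b a"
  shows "(\<Sum>a\<in>A. \<Sum>b\<in>A. f a b) = (\<Sum>a\<in>A. f a a)"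
  using assms(1)
proof (induction A)
  case (insert z A)
  have "(\<Sum>a\<in>insert z A. \<Sum>b\<in>insert z A. f a b) =
      f z z + ((\<Sum>b\<in>A. f z b) + (\<Sum>a\<in>A. f a z)) + (\<Sum>a\<in>A. \<Sum>b\<in>A. f a b)"
    using insert by (simp add: sum.distrib algebra_simps)
  also have "(\<Sum>a\<in>A. f a z) = (\<Sum>b\<in>A. f z b)"
    using sym by simp
  finally show ?case
    using insert by (simp add: double_V)
qed simp

lemma sum_square: "finite A \<Longrightarrow> (\<Sum>a\<in>A. (c a :: 'F))\<^sup>2 = (\<Sum>a\<in>A. (c a)\<^sup>2)"
proof (induction A rule: finite_induct)
  case (insert z A)
  have "(c z + s)\<^sup>2 = (c z)\<^sup>2 + s\<^sup>2 + (c z * s + c z * s)" for s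
    by (simp add: power2_eq_square algebra_simps)
  then show ?case
    using insert by (simp add: double_F)
qed simp

text \<open>The group algebra of the elementary abelian group of order \<open>q\<close> is commutative of
  characteristic two, so squaring is additive on it; as every group element squares to one, the
  square of an element is the scalar given by the square of its augmentation.\<close>

lemma unip_comb_square:
  assumes "x \<in> V"
  shows "unip_comb c (unip_comb c x) = smul ((\<Sum>a\<in>UNIV. c a)\<^sup>2) x"
proof -
  have "unip_comb c (unip_comb c x) = (\<Sum>a\<in>UNIV. smul (c a * c a) (\<rho> (unip (a + a)) x))"
    unfolding unip_comb_comp[OF assms]
    by (rule sum_symmetric_eq_diagonal) (simp_all add: add.commute mult.commute)
  also have "\<dots> = (\<Sum>a\<in>UNIV. smul (c a * c a) x)"
    by (simp add: double_eq_0[OF char_k] unip_0 rho_one assms)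
  also have "\<dots> = smul ((\<Sum>a\<in>UNIV. c a)\<^sup>2) x"
    by (simp add: sum_square scale_sum_left flip: power2_eq_square)
  finally show ?thesis .
qed

section \<open>Weight vectors\<close>

definition weight_vector :: "('k \<Rightarrow> 'F) \<Rightarrow> 'v \<Rightarrow> bool"
  where "weight_vector \<theta> v \<longleftrightarrow> v \<in> V \<and> v \<noteq> 0 \<and> (\<forall>x. \<rho> (unip x) v = v) \<and>
    (\<forall>a. a \<noteq> 0 \<longrightarrow> \<rho> (torus a) v = smul (\<theta> a) v)"

lemma unip_comb_weight_vector:
  "weight_vector \<theta> v \<Longrightarrow> unip_comb c v = smul (\<Sum>a\<in>UNIV. c a) v"
  by (simp add: unip_comb_def weight_vector_def scale_sum_left)

text \<open>Multiplication by \<open>a\<close> permutes the factors of the product of all units.\<close>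

lemma unit_power_card: "(a::'k) \<noteq> 0 \<Longrightarrow> a ^ (CARD('k) - 1) = 1"
proof -
  assume a: "a \<noteq> 0"
  have "(\<Prod>b\<in>UNIV - {0}. a * b) = (\<Prod>b\<in>UNIV - {0}. b)"
    by (rule prod.reindex_bij_witness[of _ "\<lambda>b. b / a" "\<lambda>b. a * b"]) (use a in auto)
  then have "a ^ (CARD('k) - 1) * (\<Prod>b\<in>UNIV - {0}. b) = (\<Prod>b\<in>UNIV - {0::'k}. b)"
    by (simp add: prod.distrib card_Diff_singleton)
  moreover have "(\<Prod>b\<in>UNIV - {0::'k}. b) \<noteq> 0"
    by simp
  ultimately show ?thesis
    by simp
qed

text \<open>The unipotent subgroup is an elementary abelian 2-group and so has a nonzero space of fixed
  vectors in characteristic two; it is normalised by the torus, which is commutative and acts on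
  that space by operators of order dividing \<open>q - 1\<close>.\<close>

lemma exists_weight_vector: "\<exists>v \<theta>. weight_vector \<theta> v"
proof -
  define K where "K = {x \<in> V. \<forall>a. \<rho> (unip a) x = x}"
  obtain x0 where "x0 \<in> V" "x0 \<noteq> 0"
    using nonzero subspace_0[OF subspace] by blast
  then have "\<exists>x\<in>V. x \<noteq> 0 \<and> (\<forall>a\<in>UNIV. \<rho> (unip a) x = x)"
    by (intro commuting_involutions_fixed_vector)
      (auto simp: mem_simps double_V rho_add unip_unip double_eq_0[OF char_k] unip_0 rho_one add.commute)
  then obtain x where x: "x \<in> K" "x \<noteq> 0"
    by (auto simp: K_def)
  have K: "subspace K"
    by (rule subspaceI) (auto simp: K_def mem_simps rho_zero rho_add rho_scale)
  have closed: "\<rho> (torus a) x \<in> K" if "a \<noteq> 0" "x \<in> K" for a x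
  proof -
    have "\<rho> (unip b) (\<rho> (torus a) x) = \<rho> (torus a) x" for b
      using torus_unip_act[of a x "b / a\<^sup>2"] that by (simp add: K_def)
    then show ?thesis
      using that by (simp add: K_def mem_simps)
  qed
  have power: "(\<rho> (torus a) ^^ n) x = \<rho> (torus (a ^ n)) x" if "a \<noteq> 0" "x \<in> V" for a x n
  proof (induction n)
    case 0
    have "torus 1 = (mat 1 :: 'k^2^2)" by (simp add: matrix_2_simps)
    then show ?case using that by (simp add: rho_one)
  next
    case (Suc n)
    then show ?case using that by (simp add: torus_torus)
  qed
  have "torus 1 = (mat 1 :: 'k^2^2)"
    by (simp add: matrix_2_simps)
  moreover have "CARD('k) - 1 > 0"
    using even_card zero_less_card_finite[where 'a = 'k] by presburger
  ultimately have "\<exists>x\<in>K. x \<noteq> 0 \<and> (\<exists>c. \<forall>a\<in>UNIV - {0}. \<rho> (torus a) x = smul (c a) x)"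
    using x closed
    by (intro commuting_finite_order_common_eigenvector[where m = "CARD('k) - 1",
          OF vector_space_axioms _ K])
      (auto simp: K_def rho_add rho_scale torus_torus mult.commute mem_simps power unit_power_card[simplified] rho_one)
  then show ?thesis
    unfolding weight_vector_def K_def by blast
qed

lemma weight_vector_memD: "weight_vector \<theta> v \<Longrightarrow> v \<in> V" "weight_vector \<theta> v \<Longrightarrow> \<rho> weyl v \<in> V"
    "weight_vector \<theta> v \<Longrightarrow> v \<noteq> 0"
  by (simp_all add: weight_vector_def mem_simps)

lemma weyl_weight_vector_nonzero: "weight_vector \<theta> v \<Longrightarrow> \<rho> weyl v \<noteq> 0"
  using weyl_weyl_act[of v] by (auto simp: rho_zero mem_simps weight_vector_def)

lemma torus_weyl_weight_vector:
  "weight_vector \<theta> v \<Longrightarrow> a \<noteq> 0 \<Longrightarrow>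
    \<rho> (torus a) (\<rho> weyl v) = smul (\<theta> (inverse a)) (\<rho> weyl v)"
  by (simp add: torus_weyl_act weight_vector_def rho_scale mem_simps)

lemma weight_mult:
  assumes v: "weight_vector \<theta> v" and nz: "a \<noteq> 0" "b \<noteq> 0"
  shows "\<theta> (a * b) = \<theta> a * \<theta> b"
proof -
  have "smul (\<theta> (a * b)) v = smul (\<theta> a * \<theta> b) v"
    using v nz torus_torus[of a b v] by (simp add: weight_vector_def rho_scale mem_simps mult.commute)
  then show ?thesis
    using v by (simp add: weight_vector_def)
qed

lemma bruhat_weight_vector:
  assumes v: "weight_vector \<theta> v" and g: "g \<in> carrier SL2"
  shows "(\<exists>c. \<rho> g v = smul c v) \<or> (\<exists>c x. \<rho> g v = smul c (\<rho> (unip x) (\<rho> weyl v)))"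
  using char_k g[unfolded carrier_SL2]
proof (cases rule: bruhat)
  case (borel a y)
  then have "\<rho> g v = smul (\<theta> a) v"
    using v by (simp add: rho_mult mem_simps weight_vector_def)
  then show ?thesis by blast
next
  case (big_cell x a y)
  then have "\<rho> g v = smul (\<theta> a) (\<rho> (unip x) (\<rho> weyl v))"
    using v by (simp add: rho_mult mem_simps weight_vector_def rho_scale)
  then show ?thesis by blast
qed

lemma subspace_unip_combs: "x \<in> V \<Longrightarrow> subspace (range (\<lambda>c. unip_comb c x))"
proof (rule subspaceI)
  show "0 \<in> range (\<lambda>c. unip_comb c x)"
    by (rule image_eqI[of _ _ "\<lambda>_. 0"]) (simp_all add: unip_comb_def)
qed (auto simp: add_unip_comb scale_unip_comb)

lemma unip_eq_unip_comb: "\<rho> (unip a) x = unip_comb (\<lambda>b. if b = a then 1 else 0) x"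
proof -
  have "unip_comb (\<lambda>b. if b = a then 1 else 0) x =
      (\<Sum>b\<in>UNIV. if b = a then \<rho> (unip b) x else 0)"
    unfolding unip_comb_def by (rule sum.cong) auto
  then show ?thesis by simp
qed

lemma unip_in_unip_combs: "\<rho> (unip a) x \<in> range (\<lambda>c. unip_comb c x)"
  unfolding unip_eq_unip_comb by (rule rangeI)

text \<open>By the Bruhat decomposition \<open>V\<close> is spanned by \<open>v\<close> and the vectors \<open>unip x weyl v\<close>, so it
  suffices to obtain \<open>v\<close> itself from the latter.\<close>

lemma unip_combs_of_weyl_weight_vector:
  assumes v: "weight_vector \<theta> v" and v_comb: "v \<in> range (\<lambda>c. unip_comb c (\<rho> weyl v))"
    and x: "x \<in> V"
  obtains c where "x = unip_comb c (\<rho> weyl v)"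
proof -
  let ?W = "range (\<lambda>c. unip_comb c (\<rho> weyl v))"
  have W: "subspace ?W"
    by (rule subspace_unip_combs) (rule weight_vector_memD[OF v])
  have "V \<subseteq> ?W"
  proof (rule vectors_in_span_of_orbit[OF _ _ W])
    show "\<rho> g v \<in> ?W" if "g \<in> carrier SL2" for g
      using bruhat_weight_vector[OF v that] v_comb
      by (auto intro!: subspace_scale[OF W] unip_in_unip_combs)
  qed (use v in \<open>simp_all add: weight_vector_def\<close>)
  then show ?thesis
    using x that by blast
qed

text \<open>On vectors fixed by the unipotent subgroup this is the Hecke operator of the double coset of
  \<open>weyl\<close>.\<close>

definition unip_sum :: "'v \<Rightarrow> 'v"
  where "unip_sum v = unip_comb (\<lambda>_. 1) (\<rho> weyl v)"

text \<open>In \<open>weyl unip x weyl v\<close> the element \<open>x = 0\<close> gives back \<open>v\<close>, and every other \<open>x\<close> leads to the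
  big cell.\<close>

lemma weyl_unip_sum:
  assumes v: "weight_vector \<theta> v"
  shows "\<rho> weyl (unip_sum v) =
    v + unip_comb (\<lambda>x. if x = 0 then 0 else \<theta> (inverse x)) (\<rho> weyl v)"
proof -
  have mem: "v \<in> V" "\<rho> weyl v \<in> V"
    using weight_vector_memD[OF v] by auto
  have cell: "\<rho> weyl (\<rho> (unip x) (\<rho> weyl v)) =
      smul (\<theta> x) (\<rho> (unip (inverse x)) (\<rho> weyl v))" if "x \<noteq> 0" for x
  proof -
    have "\<rho> weyl (\<rho> (unip x) (\<rho> weyl v)) = \<rho> (weyl ** (unip x ** weyl)) v"
      by (simp add: rho_mult mem_simps mem)
    also have "\<dots> = smul (\<theta> x) (\<rho> (unip (inverse x)) (\<rho> weyl v))"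
      unfolding weyl_unip_weyl[OF char_k that]
      using v that by (simp add: rho_mult mem_simps weight_vector_def rho_scale)
    finally show ?thesis .
  qed
  have "\<rho> weyl (unip_sum v) = (\<Sum>x\<in>UNIV. \<rho> weyl (\<rho> (unip x) (\<rho> weyl v)))"
    by (simp add: unip_sum_def unip_comb_def rho_sum mem_simps mem)
  also have "\<dots> = v + (\<Sum>x\<in>UNIV - {0}. \<rho> weyl (\<rho> (unip x) (\<rho> weyl v)))"
    by (subst sum.remove[of _ 0]) (simp_all add: unip_0 rho_one mem weyl_weyl_act)
  also have "(\<Sum>x\<in>UNIV - {0}. \<rho> weyl (\<rho> (unip x) (\<rho> weyl v))) =
      (\<Sum>x\<in>UNIV - {0}. smul (\<theta> (inverse x)) (\<rho> (unip x) (\<rho> weyl v)))"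
    by (rule sum.reindex_bij_witness[of _ inverse inverse]) (auto simp: cell)
  also have "\<dots> = unip_comb (\<lambda>x. if x = 0 then 0 else \<theta> (inverse x)) (\<rho> weyl v)"
    unfolding unip_comb_def by (rule sum.mono_neutral_cong_left) auto
  finally show ?thesis .
qed

text \<open>If \<open>unip_sum v\<close> vanishes, the preceding identity expresses \<open>v\<close> through the vectors
  \<open>unip x weyl v\<close>.\<close>

lemma unip_combs_of_weyl_weight_vector_if_unip_sum_0:
  assumes v: "weight_vector \<theta> v" and "unip_sum v = 0" and x: "x \<in> V"
  obtains c where "x = unip_comb c (\<rho> weyl v)"
proof (rule unip_combs_of_weyl_weight_vector[OF v _ x])
  have "v + unip_comb (\<lambda>x. if x = 0 then 0 else \<theta> (inverse x)) (\<rho> weyl v) = 0"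
    using weyl_unip_sum[OF v] assms(2) by (simp add: rho_zero mem_simps)
  then have "v = unip_comb (\<lambda>x. if x = 0 then 0 else \<theta> (inverse x)) (\<rho> weyl v)"
    using neg_V by (simp add: add_eq_0_iff)
  then show "v \<in> range (\<lambda>c. unip_comb c (\<rho> weyl v))"
    by blast
qed

text \<open>Orthogonality of characters: substituting \<open>b x\<close> for \<open>x\<close> multiplies the sum by \<open>\<theta> b\<close>.\<close>

lemma sum_nontrivial_weight:
  assumes v: "weight_vector \<theta> v" and b: "b \<noteq> 0" "\<theta> b \<noteq> 1"
  shows "(\<Sum>x\<in>UNIV. if x = 0 then 0 else \<theta> (inverse x)) = 0"
proof -
  let ?s = "\<Sum>x\<in>UNIV - {0}. \<theta> x"
  have "?s = (\<Sum>x\<in>UNIV - {0}. \<theta> (b * x))"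
    by (rule sum.reindex_bij_witness[of _ "\<lambda>x. b * x" "\<lambda>x. x / b"]) (use b in auto)
  also have "\<dots> = \<theta> b * ?s"
    using b by (simp add: weight_mult[OF v] sum_distrib_left)
  finally have "(\<theta> b - 1) * ?s = 0"
    by (simp add: algebra_simps)
  then have "?s = 0"
    using b by simp
  moreover have "(\<Sum>x\<in>UNIV. if x = 0 then 0 else \<theta> (inverse x)) =
      (\<Sum>x\<in>UNIV - {0}. \<theta> (inverse x))"
    by (rule sum.mono_neutral_cong_right) auto
  moreover have "(\<Sum>x\<in>UNIV - {0}. \<theta> (inverse x)) = ?s"
    by (rule sum.reindex_bij_witness[of _ inverse inverse]) auto
  ultimately show ?thesis
    by simp
qed

lemma unip_unip_sum: "weight_vector \<theta> v \<Longrightarrow> \<rho> (unip a) (unip_sum v) = unip_sum v"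
  by (simp add: unip_sum_def unip_act_comb weight_vector_memD)

text \<open>If \<open>z = unip_sum v\<close> did not vanish, it would be a weight vector with \<open>unip_sum z = 0\<close>,
  because \<open>unip_sum z\<close> is \<open>z\<close> times the sum of the values of \<open>\<theta>\<close>. So \<open>V\<close> would be generated
  by \<open>weyl z\<close> over the unipotent subgroup, and as the sum of the unipotent elements kills this
  generator it would kill \<open>V\<close>, although it maps \<open>weyl v\<close> to \<open>z\<close>.\<close>

lemma unip_sum_nontrivial_weight:
  assumes v: "weight_vector \<theta> v" and b: "b \<noteq> 0" "\<theta> b \<noteq> 1"
  shows "unip_sum v = 0"
proof (rule ccontr)
  let ?z = "unip_sum v" and ?c = "\<lambda>x. if x = 0 then 0 else \<theta> (inverse x)"
  assume nz: "?z \<noteq> 0"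
  have mem: "v \<in> V" "\<rho> weyl v \<in> V" "?z \<in> V" "\<rho> weyl ?z \<in> V"
    using weight_vector_memD[OF v] by (simp_all add: unip_sum_def unip_comb_closed mem_simps)
  have "\<rho> (torus a) ?z = smul (\<theta> (inverse a)) ?z" if "a \<noteq> 0" for a
    using that by (simp add: unip_sum_def torus_act_comb mem torus_weyl_weight_vector[OF v]
        unip_comb_scale)
  then have z: "weight_vector (\<lambda>a. \<theta> (inverse a)) ?z"
    using nz mem unip_unip_sum[OF v] by (simp add: weight_vector_def)
  have "unip_sum ?z = unip_comb (\<lambda>_. 1) (v + unip_comb ?c (\<rho> weyl v))"
    by (simp add: unip_sum_def[of ?z] weyl_unip_sum[OF v])
  also have "\<dots> = unip_comb (\<lambda>_. 1) v + unip_comb ?c ?z"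
    by (simp add: unip_comb_add mem unip_comb_closed unip_comb_commute[of _ "\<lambda>_. 1"]
        flip: unip_sum_def)
  also have "\<dots> = 0"
    using unip_comb_weight_vector[OF v] unip_comb_weight_vector[OF z]
      sum_nontrivial_weight[OF v b] by (simp add: card_F)
  finally have "unip_sum ?z = 0" .
  with z obtain d where d: "\<rho> weyl v = unip_comb d (\<rho> weyl ?z)"
    using mem(2) by (rule unip_combs_of_weyl_weight_vector_if_unip_sum_0)
  have "?z = unip_comb (\<lambda>_. 1) (unip_comb d (\<rho> weyl ?z))"
    using arg_cong[OF d, of "unip_comb (\<lambda>_. 1)"] by (simp only: flip: unip_sum_def)
  also have "\<dots> = unip_comb d (unip_sum ?z)"
    unfolding unip_sum_def[of ?z] by (rule unip_comb_commute[OF mem(4)])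
  finally show False
    using nz \<open>unip_sum ?z = 0\<close> by (simp add: unip_comb_zero)
qed

text \<open>A generator of \<open>V\<close> over the group algebra of the unipotent subgroup is mapped to another one
  by an element of nonzero augmentation, and an element that kills a generator has augmentation
  zero. Comparing the action of the torus on the generators \<open>weyl v\<close> and \<open>weyl y\<close> gives an
  element of the latter kind whose augmentation is a nonzero multiple of the difference of the
  weights.\<close>

lemma weight_unique:
  assumes v: "weight_vector \<theta> v" "unip_sum v = 0" and y: "weight_vector \<psi> y" "unip_sum y = 0"
    and a: "a \<noteq> 0"
  shows "\<theta> a = \<psi> a"
proof -
  let ?e = "\<rho> weyl v" and ?f = "\<rho> weyl y"
  have mem: "?e \<in> V" "?f \<in> V"
    using v y by (simp_all add: weight_vector_memD)
  have e0: "?e \<noteq> 0"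
    using v by (simp add: weyl_weight_vector_nonzero)
  obtain \<alpha> where \<alpha>: "?e = unip_comb \<alpha> ?f"
    using y mem(1) by (rule unip_combs_of_weyl_weight_vector_if_unip_sum_0)
  obtain \<beta> where \<beta>: "?f = unip_comb \<beta> ?e"
    using v mem(2) by (rule unip_combs_of_weyl_weight_vector_if_unip_sum_0)
  define s where "s = (\<Sum>b\<in>UNIV. \<beta> b)"
  have "?e = unip_comb \<alpha> (unip_comb \<beta> (unip_comb \<alpha> (unip_comb \<beta> ?e)))"
    using \<alpha> \<beta> by simp
  also have "\<dots> = unip_comb \<alpha> (unip_comb \<alpha> (unip_comb \<beta> (unip_comb \<beta> ?e)))"
    by (simp add: unip_comb_commute[of "unip_comb \<beta> ?e" \<alpha> \<beta>] unip_comb_closed mem)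
  also have "unip_comb \<beta> (unip_comb \<beta> ?e) = smul (s\<^sup>2) ?e"
    by (simp add: unip_comb_square mem s_def)
  also have "unip_comb \<alpha> (unip_comb \<alpha> (smul (s\<^sup>2) ?e)) = smul ((sum \<alpha> UNIV)\<^sup>2 * s\<^sup>2) ?e"
    by (simp add: unip_comb_square mem mem_simps)
  finally have s0: "s \<noteq> 0"
    using e0 by auto
  have inv: "inverse a \<noteq> 0"
    using a by simp
  define \<gamma> where "\<gamma> b = \<psi> a * \<beta> b + \<theta> a * \<beta> (b / (inverse a)\<^sup>2)" for b
  have "smul (\<psi> a) ?f = \<rho> (torus (inverse a)) (unip_comb \<beta> ?e)"
    using torus_weyl_weight_vector[OF y(1) inv] \<beta> by simp
  also have "\<dots> = unip_comb (\<lambda>b. \<beta> (b / (inverse a)\<^sup>2)) (smul (\<theta> a) ?e)"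
    using torus_weyl_weight_vector[OF v(1) inv] by (simp only: torus_act_comb[OF inv mem(1)]) simp
  finally have "unip_comb \<gamma> ?e = smul (\<psi> a) ?f + smul (\<psi> a) ?f"
    unfolding \<gamma>_def by (simp add: unip_comb_scale mem \<beta>[symmetric] flip: add_unip_comb scale_unip_comb)
  then have "unip_comb \<gamma> (unip_comb \<gamma> ?e) = 0"
    by (simp add: double_V unip_comb_zero)
  then have "(\<Sum>b\<in>UNIV. \<gamma> b) = 0"
    using unip_comb_square[OF mem(1), of \<gamma>] e0 by simp
  moreover have "(\<Sum>b\<in>UNIV. \<beta> (b / (inverse a)\<^sup>2)) = s"
    unfolding s_def
    by (rule sum.reindex_bij_witness[of _ "\<lambda>b. b * (inverse a)\<^sup>2" "\<lambda>b. b / (inverse a)\<^sup>2"])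
      (use inv in auto)
  ultimately have "(\<psi> a + \<theta> a) * s = 0"
    by (simp add: \<gamma>_def sum.distrib s_def distrib_right flip: sum_distrib_left)
  then have "\<psi> a + \<theta> a = 0"
    using s0 by simp
  then show ?thesis
    using minus_unique uminus_eq_self[OF char_F] by metis
qed

end

section \<open>Rational traces force a trivial weight\<close>

context char2_SL2_rep
begin

lemma endo_trace_unip_comb:
  assumes Y: "\<And>x. x \<in> V \<Longrightarrow> Y x \<in> V" "\<And>x y. x \<in> V \<Longrightarrow> y \<in> V \<Longrightarrow> Y (x + y) = Y x + Y y"
    "\<And>c x. x \<in> V \<Longrightarrow> Y (smul c x) = smul c (Y x)"
    and gh: "g \<in> carrier SL2" "h \<in> carrier SL2"
  shows "endo_trace smul V (\<lambda>x. Y (\<rho> g (unip_comb c (\<rho> h x)))) =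
    (\<Sum>a\<in>UNIV. c a * endo_trace smul V (\<lambda>x. Y (\<rho> (g ** (unip a ** h)) x)))"
proof (rule endo_trace_linear_combination)
  have Y0: "Y 0 = 0"
    using Y(3)[of 0 0] subspace_0[OF subspace] by simp
  have Y_sum: "Y (sum f I) = (\<Sum>i\<in>I. Y (f i))" if "\<And>i. f i \<in> V" for f and I :: "'k set"
    by (induction I rule: infinite_finite_induct) (auto simp: Y0 Y that mem_simps)
  show "Y (\<rho> g (unip_comb c (\<rho> h x))) =
      (\<Sum>a\<in>UNIV. smul (c a) (Y (\<rho> (g ** (unip a ** h)) x)))" if "x \<in> V" for x
    using that gh by (simp add: unip_comb_def rho_sum rho_scale rho_mult mem_simps Y_sum Y)
qed (use gh in \<open>simp add: Y mem_simps\<close>)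

text \<open>The operators \<open>g a h\<close> with \<open>a\<close> the given operator of rank one are combinations of group
  elements, so all \<open>Y g a h\<close> have trace zero; these traces are the values of \<open>l\<close> on the orbits of
  the vectors \<open>Y g v\<close>.\<close>

lemma trace_nondegenerate:
  assumes v: "v \<in> V" "v \<noteq> 0" and e: "e \<in> V" "l e \<noteq> 0"
    and l: "\<And>x y. x \<in> V \<Longrightarrow> y \<in> V \<Longrightarrow> l (x + y) = l x + l y"
      "\<And>c x. x \<in> V \<Longrightarrow> l (smul c x) = c * l x"
    and rank_one: "\<And>x. x \<in> V \<Longrightarrow> unip_comb \<alpha> x = smul (l x) v"
    and Y: "\<And>x. x \<in> V \<Longrightarrow> Y x \<in> V" "\<And>x y. x \<in> V \<Longrightarrow> y \<in> V \<Longrightarrow> Y (x + y) = Y x + Y y"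
      "\<And>c x. x \<in> V \<Longrightarrow> Y (smul c x) = smul c (Y x)"
    and trace: "\<And>g. g \<in> carrier SL2 \<Longrightarrow> endo_trace smul V (\<lambda>x. Y (\<rho> g x)) = 0"
    and x: "x \<in> V"
  shows "Y x = 0"
proof -
  have l0: "l 0 = 0" and Y0: "Y 0 = 0"
    using l(2)[of 0 0] Y(3)[of 0 0] subspace_0[OF subspace] by simp_all
  have l_orbit: "l (\<rho> h (Y (\<rho> g v))) = 0" if "g \<in> carrier SL2" "h \<in> carrier SL2" for g h
  proof -
    have "l (\<rho> h (Y (\<rho> g v))) = endo_trace smul V (\<lambda>x. Y (\<rho> g (unip_comb \<alpha> (\<rho> h x))))"
      using that v
      by (subst endo_trace_rank_one[where v = "Y (\<rho> g v)" and l = "\<lambda>x. l (\<rho> h x)"])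
        (auto simp: rank_one l Y rho_add rho_scale mem_simps)
    also have "\<dots> = 0"
      using that by (simp add: endo_trace_unip_comb[OF Y] trace mem_simps)
    finally show ?thesis .
  qed
  have "subspace {x \<in> V. l x = 0}"
    by (rule subspaceI) (auto simp: mem_simps l l0)
  then have "Y (\<rho> g v) = 0" if g: "g \<in> carrier SL2" for g
    using vectors_in_span_of_orbit[of "Y (\<rho> g v)" "{x \<in> V. l x = 0}"] e
      l_orbit[OF g] Y(1)[OF rho_closed[OF g v(1)]] by (auto simp: mem_simps)
  moreover have "subspace {x \<in> V. Y x = 0}"
    by (rule subspaceI) (auto simp: mem_simps Y Y0)
  ultimately have "V \<subseteq> {x \<in> V. Y x = 0}"
    using vectors_in_span_of_orbit[OF v, of "{x \<in> V. Y x = 0}"] v by (auto simp: mem_simps)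
  then show ?thesis
    using x by blast
qed

text \<open>Squaring the coefficients of an element of the group algebra squares its trace, since the
  traces of group elements lie in the prime field. This turns an operator of rank one whose image
  is spanned by a vector of weight \<open>\<theta>\<close> into an operator whose image consists of vectors of weight
  \<open>\<theta>\<^sup>2\<close>; it is the shadow of an isomorphism of \<open>V\<close> with its Frobenius twist.\<close>

lemma squared_weight:
  assumes trace: "\<And>g. g \<in> carrier SL2 \<Longrightarrow> endo_trace smul V (\<rho> g) \<in> {0, 1}"
    and v: "weight_vector \<theta> v" "unip_sum v = 0"
  obtains y where "weight_vector (\<lambda>a. (\<theta> a)\<^sup>2) y"
proof -
  let ?e = "\<rho> weyl v"
  have mem: "v \<in> V" "?e \<in> V" and v0: "v \<noteq> 0"
    using weight_vector_memD[OF v(1)] by auto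
  \<comment> \<open>As the group algebra of the unipotent subgroup is commutative, \<open>\<alpha>\<close> maps \<open>\<beta> weyl v\<close> to \<open>\<beta> v\<close>,
    which is a multiple of \<open>v\<close>.\<close>
  obtain \<alpha> where \<alpha>: "v = unip_comb \<alpha> ?e"
    using v mem(1) by (rule unip_combs_of_weyl_weight_vector_if_unip_sum_0)
  have "\<exists>k. unip_comb \<alpha> x = smul k v" if x: "x \<in> V" for x
  proof -
    obtain \<beta> where \<beta>: "x = unip_comb \<beta> ?e"
      using v x by (rule unip_combs_of_weyl_weight_vector_if_unip_sum_0)
    have "unip_comb \<alpha> x = unip_comb \<beta> v"
      unfolding \<beta> by (subst unip_comb_commute[OF mem(2)]) (simp flip: \<alpha>)
    then show ?thesis
      using unip_comb_weight_vector[OF v(1)] by auto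
  qed
  then obtain l where l: "\<And>x. x \<in> V \<Longrightarrow> unip_comb \<alpha> x = smul (l x) v"
    by metis
  have l_add: "l (x + y) = l x + l y" if "x \<in> V" "y \<in> V" for x y
  proof -
    have "smul (l (x + y)) v = smul (l x + l y) v"
      using that l by (simp add: mem_simps unip_comb_add scale_left_distrib flip: l)
    then show ?thesis using v0 by simp
  qed
  have l_scale: "l (smul c x) = c * l x" if "x \<in> V" for c x
  proof -
    have "smul (l (smul c x)) v = smul (c * l x) v"
      using that l by (simp add: mem_simps unip_comb_scale flip: l scale_scale)
    then show ?thesis using v0 by simp
  qed
  have l_e: "l ?e = 1"
  proof -
    have "smul (l ?e) v = smul 1 v"
      using l[OF mem(2)] \<alpha> by simp
    then show ?thesis using v0 unfolding scale_cancel_right by simp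
  qed
  define \<alpha>2 where "\<alpha>2 a = (\<alpha> a)\<^sup>2" for a
  have frobenius: "endo_trace smul V (\<lambda>x. \<rho> b (unip_comb \<alpha>2 (\<rho> g x))) = (c * l (\<rho> g v))\<^sup>2"
    if b: "b \<in> carrier SL2" "\<rho> b v = smul c v" and g: "g \<in> carrier SL2" for b c g
  proof -
    have tr: "endo_trace smul V (\<lambda>x. \<rho> b (unip_comb d (\<rho> g x))) =
        (\<Sum>a\<in>UNIV. d a * endo_trace smul V (\<rho> (b ** (unip a ** g))))" for d
      using endo_trace_unip_comb[of "\<lambda>x. x" b g d] b g by simp
    have idem: "(endo_trace smul V (\<rho> (b ** (unip a ** g))))\<^sup>2 =
        endo_trace smul V (\<rho> (b ** (unip a ** g)))" for a
      using trace[of "b ** (unip a ** g)"] b g by (auto simp: mem_simps)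
    have "endo_trace smul V (\<lambda>x. \<rho> b (unip_comb \<alpha> (\<rho> g x))) = l (\<rho> g (smul c v))"
      using b g mem
      by (subst endo_trace_rank_one[where v = "smul c v" and l = "\<lambda>x. l (\<rho> g x)"])
        (auto simp: l l_add l_scale rho_add rho_scale mem_simps)
    then have "(\<Sum>a\<in>UNIV. \<alpha> a * endo_trace smul V (\<rho> (b ** (unip a ** g)))) = c * l (\<rho> g v)"
      using g mem by (simp add: tr rho_scale l_scale mem_simps)
    then have "(\<Sum>a\<in>UNIV. (\<alpha> a * endo_trace smul V (\<rho> (b ** (unip a ** g))))\<^sup>2) =
        (c * l (\<rho> g v))\<^sup>2"
      by (simp flip: sum_square)
    then show ?thesis
      by (simp add: tr \<alpha>2_def power_mult_distrib idem)
  qed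
  have eigen: "\<rho> b (unip_comb \<alpha>2 x) = smul (c\<^sup>2) (unip_comb \<alpha>2 x)"
    if b: "b \<in> carrier SL2" "\<rho> b v = smul c v" and x: "x \<in> V" for b c x
  proof -
    define Y where "Y x = \<rho> b (unip_comb \<alpha>2 x) - smul (c\<^sup>2) (unip_comb \<alpha>2 x)" for x
    have "Y x = 0"
    proof (rule trace_nondegenerate[OF mem(1) v0 mem(2) _ l_add l_scale l _ _ _ _ x])
      show "endo_trace smul V (\<lambda>x. Y (\<rho> g x)) = 0" if g: "g \<in> carrier SL2" for g
      proof -
        have one: "(mat 1 :: 'k^2^2) \<in> carrier SL2" "\<rho> (mat 1) v = smul 1 v"
          using mem by (simp_all add: mem_simps rho_one)
        have "endo_trace smul V (\<lambda>x. Y (\<rho> g x)) = (\<Sum>i\<in>UNIV. (if i then 1 else - (c\<^sup>2)) *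
            endo_trace smul V (\<lambda>x. \<rho> (if i then b else mat 1) (unip_comb \<alpha>2 (\<rho> g x))))"
          using g b one
          by (intro endo_trace_linear_combination)
            (auto simp: Y_def UNIV_bool mem_simps unip_comb_closed rho_one)
        also have "\<dots> = 0"
          using frobenius[OF b g] frobenius[OF one g]
          by (simp add: UNIV_bool power_mult_distrib)
        finally show ?thesis .
      qed
      show "l ?e \<noteq> 0"
        using l_e by simp
      show "Y x \<in> V" if "x \<in> V" for x
        using that b(1) by (simp add: Y_def unip_comb_closed mem_simps)
      show "Y (x + y) = Y x + Y y" if "x \<in> V" "y \<in> V" for x y
        using that b(1)
        by (simp add: Y_def unip_comb_closed unip_comb_add rho_add scale_right_distrib)
      show "Y (smul d x) = smul d (Y x)" if "x \<in> V" for d x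
        using that b(1)
        by (simp add: Y_def unip_comb_closed unip_comb_scale rho_scale scale_right_diff_distrib
            mult.commute)
    qed
    then show ?thesis
      by (simp add: Y_def)
  qed
  \<comment> \<open>The operator does not vanish, since its product with \<open>weyl\<close> has trace \<open>(l (weyl v))\<^sup>2 = 1\<close>.\<close>
  have "\<exists>x\<in>V. unip_comb \<alpha>2 x \<noteq> 0"
  proof (rule ccontr)
    assume "\<not> ?thesis"
    then have "\<rho> (mat 1) (unip_comb \<alpha>2 (\<rho> weyl x)) = 0" if "x \<in> V" for x
      using that rho_closed[OF carriers(3)] by (simp add: rho_zero carriers)
    then have "endo_trace smul V (\<lambda>x. \<rho> (mat 1) (unip_comb \<alpha>2 (\<rho> weyl x))) =
        (\<Sum>i\<in>({} :: nat set). 0 * endo_trace smul V (\<lambda>x. x))"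
      by (intro endo_trace_linear_combination) simp_all
    moreover have "endo_trace smul V (\<lambda>x. \<rho> (mat 1) (unip_comb \<alpha>2 (\<rho> weyl x))) = 1"
      using frobenius[of "mat 1" 1 weyl] mem(1) l_e by (simp add: rho_one carriers)
    ultimately show False
      by simp
  qed
  then obtain x where x: "x \<in> V" "unip_comb \<alpha>2 x \<noteq> 0"
    by (elim bexE)
  have "\<rho> (unip a) (unip_comb \<alpha>2 x) = unip_comb \<alpha>2 x" for a
    using eigen[of "unip a" 1 x] x(1) v(1) by (simp add: weight_vector_def mem_simps)
  moreover have "\<rho> (torus a) (unip_comb \<alpha>2 x) = smul ((\<theta> a)\<^sup>2) (unip_comb \<alpha>2 x)" if "a \<noteq> 0" for a
    using eigen[of "torus a" "\<theta> a" x] x(1) v(1) that by (simp add: weight_vector_def mem_simps)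
  ultimately have "weight_vector (\<lambda>a. (\<theta> a)\<^sup>2) (unip_comb \<alpha>2 x)"
    using x by (simp add: weight_vector_def unip_comb_closed)
  then show ?thesis
    by (rule that)
qed

text \<open>If \<open>\<theta>\<close> is not trivial then neither is \<open>\<theta>\<^sup>2\<close> in characteristic two, so the weights \<open>\<theta>\<close> and \<open>\<theta>\<^sup>2\<close>
  agree by uniqueness, which leaves only the values \<open>0\<close> and \<open>1\<close>.\<close>

lemma exists_vector_of_trivial_weight:
  assumes trace: "\<And>g. g \<in> carrier SL2 \<Longrightarrow> endo_trace smul V (\<rho> g) \<in> {0, 1}"
  shows "\<exists>v. weight_vector (\<lambda>_. 1) v"
proof -
  obtain v \<theta> where v: "weight_vector \<theta> v"
    using exists_weight_vector by blast
  have "\<theta> b = 1" if b: "b \<noteq> 0" for b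
  proof (rule ccontr)
    assume nontrivial: "\<theta> b \<noteq> 1"
    then have sum_v: "unip_sum v = 0"
      by (rule unip_sum_nontrivial_weight[OF v b])
    obtain y where y: "weight_vector (\<lambda>a. (\<theta> a)\<^sup>2) y"
      using trace v sum_v by (rule squared_weight)
    have "(\<theta> b)\<^sup>2 \<noteq> 1"
      using nontrivial by (simp add: power2_eq_1_iff uminus_eq_self[OF char_F])
    then have "unip_sum y = 0"
      by (rule unip_sum_nontrivial_weight[OF y b])
    then have "(\<theta> b)\<^sup>2 = \<theta> b"
      by (rule weight_unique[OF v sum_v y _ b, symmetric])
    then have "\<theta> b * \<theta> b = \<theta> b * 1"
      by (simp add: power2_eq_square)
    then have "\<theta> b = 0"
      using nontrivial unfolding mult_cancel_left by blast
    then have "\<theta> (inverse b * b) = 0"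
      using weight_mult[OF v, of "inverse b" b] b by simp
    then have "\<rho> (torus 1) v = 0"
      using v b by (simp add: weight_vector_def)
    moreover have "torus 1 = (mat 1 :: 'k^2^2)"
      by (simp add: matrix_2_simps)
    ultimately show False
      using v by (simp add: weight_vector_def rho_one)
  qed
  then have "weight_vector (\<lambda>_. 1) v"
    using v by (simp add: weight_vector_def)
  then show ?thesis ..
qed

end

section \<open>A vector of trivial weight generates the Steinberg representation\<close>

context char2_SL2_rep
begin

text \<open>The fixed vectors form an invariant subspace; if it were all of \<open>V\<close>, all group elements would
  act in the same way.\<close>

lemma faithful_fixed_vector_zero:
  assumes faithful: "inj_on \<rho> (carrier SL2)"
    and x: "x \<in> V" "\<And>g. g \<in> carrier SL2 \<Longrightarrow> \<rho> g x = x"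
  shows "x = 0"
proof (rule ccontr)
  assume x0: "x \<noteq> 0"
  let ?F = "{y \<in> V. \<forall>g\<in>carrier SL2. \<rho> g y = y}"
  have "V \<subseteq> ?F"
  proof (rule vectors_in_span_of_orbit[OF x(1) x0])
    show "subspace ?F"
      by (rule subspaceI) (simp_all add: rho_zero rho_add rho_scale mem_simps)
    show "\<rho> g x \<in> ?F" if "g \<in> carrier SL2" for g
      using x that by simp
  qed
  then have trivial: "\<rho> g y = y" if "g \<in> carrier SL2" "y \<in> V" for g y
    using that by auto
  have "\<rho> g \<in> extensional V" if "g \<in> carrier SL2" for g
    using group_hom.hom_closed[OF group_hom that] by (simp add: BijGroup_def Bij_def)
  then have "\<rho> (unip 1) = \<rho> (mat 1)"
    by (intro extensionalityI[of _ V]) (simp_all add: carriers trivial)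
  then have "unip 1 = (mat 1 :: 'k^2^2)"
    by (rule inj_onD[OF faithful]) (simp_all add: carriers)
  then have "(unip 1 :: 'k^2^2) $ 1 $ 2 = (mat 1 :: 'k^2^2) $ 1 $ 2"
    by (rule arg_cong)
  then show False
    by (simp add: unip_def mat_def)
qed

lemma inv_SL2:
  assumes "(g :: 'k^2^2) \<in> carrier SL2"
  shows "inv\<^bsub>SL2\<^esub> g \<in> carrier SL2" "inv\<^bsub>SL2\<^esub> g ** g = mat 1" "g ** inv\<^bsub>SL2\<^esub> g = mat 1"
proof -
  interpret G: group "SL2 :: ('k^2^2) monoid"
    using group_hom by (simp add: group_hom_def)
  show "inv\<^bsub>SL2\<^esub> g \<in> carrier SL2" "inv\<^bsub>SL2\<^esub> g ** g = mat 1" "g ** inv\<^bsub>SL2\<^esub> g = mat 1"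
    using assms G.inv_closed G.l_inv G.r_inv by (simp_all add: mult_SL2 one_SL2)
qed

lemma line_act_inv:
  assumes "(g :: 'k^2^2) \<in> carrier SL2"
  shows "line_act (inv\<^bsub>SL2\<^esub> g) (line_act g L) = L" "line_act g (line_act (inv\<^bsub>SL2\<^esub> g) L) = L"
  using assms by (simp_all add: inv_SL2 line_act_one flip: line_act_mult)

lemma line_act_projective_line:
  assumes g: "(g :: 'k^2^2) \<in> carrier SL2"
  shows "line_act g L \<in> projective_line \<longleftrightarrow> L \<in> projective_line"
proof -
  have "line_act h M \<in> projective_line" if h: "h \<in> carrier SL2" and M: "M \<in> projective_line" for h M
  proof -
    obtain k where k: "k \<in> carrier SL2" "M = line_act k line_at_infinity"
      using M by (auto simp: projective_line_homogeneous)
    have "line_act h M = line_act (h ** k) line_at_infinity"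
      by (simp add: k(2) line_act_mult)
    then show ?thesis
      unfolding projective_line_homogeneous using carriers(5)[OF h k(1)] by (rule image_eqI)
  qed
  from this[OF g, of L] this[OF inv_SL2(1)[OF g], of "line_act g L"] show ?thesis
    unfolding line_act_inv[OF g] by blast
qed

lemma sum_projective_line:
  fixes f :: "('k^2) set \<Rightarrow> 'b::comm_monoid_add"
  shows "(\<Sum>L\<in>projective_line. f L) = f line_at_infinity + (\<Sum>x\<in>UNIV. f (affine_line x))"
proof -
  have "line_at_infinity \<notin> range (affine_line :: 'k \<Rightarrow> _)"
    using affine_line_neq_infinity by (metis rangeE)
  then show ?thesis
    by (simp add: projective_line_eq[OF char_k] sum.reindex[OF inj_affine_line])
qed

lemma sum_line_act:
  assumes g: "(g :: 'k^2^2) \<in> carrier SL2"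
  shows "(\<Sum>L\<in>projective_line. f (line_act g L)) = (\<Sum>L\<in>projective_line. f L)"
  by (rule sum.reindex_bij_witness[of _ "line_act (inv\<^bsub>SL2\<^esub> g)" "line_act g"])
    (simp_all add: line_act_inv line_act_projective_line inv_SL2 g)

text \<open>The stabiliser of the line at infinity is the Borel subgroup, which fixes a vector of trivial
  weight; so the orbit of such a vector is parametrised by the projective line.\<close>

definition orbit_vector :: "'v \<Rightarrow> ('k^2) set \<Rightarrow> 'v"
  where "orbit_vector v L =
    \<rho> (SOME g. g \<in> carrier SL2 \<and> line_act g line_at_infinity = L) v"

lemma orbit_vector_line_act_infinity:
  assumes v: "weight_vector (\<lambda>_. 1) v" and g: "g \<in> carrier SL2"
  shows "orbit_vector v (line_act g line_at_infinity) = \<rho> g v"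
proof -
  let ?P = "\<lambda>h. h \<in> carrier SL2 \<and> line_act h line_at_infinity = line_act g line_at_infinity"
  define h where "h = Eps ?P"
  have "?P h"
    unfolding h_def by (rule someI[of ?P g]) (simp add: g)
  then have h: "h \<in> carrier SL2" "line_act h line_at_infinity = line_act g line_at_infinity"
    by simp_all
  define b where "b = inv\<^bsub>SL2\<^esub> g ** h"
  have b: "b \<in> carrier SL2"
    by (simp add: b_def carriers inv_SL2 g h)
  have stab: "line_act b line_at_infinity = line_at_infinity"
    by (simp add: b_def line_act_mult h line_act_inv g)
  have "\<rho> b v = v"
    using char_k b[unfolded carrier_SL2]
  proof (cases rule: bruhat)
    case (borel a y)
    then show ?thesis
      using v by (simp add: rho_mult mem_simps weight_vector_def)
  next
    case (big_cell x a y)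
    then have "line_act b line_at_infinity = line_act (unip x ** weyl) line_at_infinity"
      by (simp add: line_act_mult line_act_unip line_act_torus)
    then show ?thesis
      using stab affine_line_neq_infinity[of x] by (simp add: line_act_unip_weyl)
  qed
  moreover have "h = g ** b"
    by (simp add: b_def matrix_mul_assoc inv_SL2 g)
  ultimately have "\<rho> h v = \<rho> g v"
    using rho_mult[OF g b] v by (simp add: weight_vector_def)
  then show ?thesis
    by (simp add: orbit_vector_def h_def)
qed

lemma orbit_vector_closed:
  "weight_vector (\<lambda>_. 1) v \<Longrightarrow> L \<in> projective_line \<Longrightarrow> orbit_vector v L \<in> V"
  by (auto simp: projective_line_homogeneous orbit_vector_line_act_infinity rho_closed
      weight_vector_memD)

lemma orbit_vector_line_act:
  assumes v: "weight_vector (\<lambda>_. 1) v" and g: "g \<in> carrier SL2" and L: "L \<in> projective_line"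
  shows "orbit_vector v (line_act g L) = \<rho> g (orbit_vector v L)"
proof -
  obtain h where h: "h \<in> carrier SL2" "L = line_act h line_at_infinity"
    using L by (auto simp: projective_line_homogeneous)
  have "orbit_vector v (line_act (g ** h) line_at_infinity) = \<rho> (g ** h) v"
    using v carriers(5)[OF g h(1)] by (rule orbit_vector_line_act_infinity)
  then show ?thesis
    using v g h by (simp add: line_act_mult rho_mult orbit_vector_line_act_infinity
        weight_vector_memD)
qed

definition orbit_sum :: "'v \<Rightarrow> (('k^2) set \<Rightarrow> 'F) \<Rightarrow> 'v"
  where "orbit_sum v h = (\<Sum>L\<in>projective_line. smul (h L) (orbit_vector v L))"

lemma orbit_sum_closed: "weight_vector (\<lambda>_. 1) v \<Longrightarrow> orbit_sum v h \<in> V"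
  by (simp add: orbit_sum_def orbit_vector_closed mem_simps)

lemma orbit_sum_line_act:
  assumes v: "weight_vector (\<lambda>_. 1) v" and g: "g \<in> carrier SL2"
  shows "orbit_sum v (\<lambda>L. h (line_act (inv\<^bsub>SL2\<^esub> g) L)) = \<rho> g (orbit_sum v h)"
proof -
  have "orbit_sum v (\<lambda>L. h (line_act (inv\<^bsub>SL2\<^esub> g) L)) =
      (\<Sum>L\<in>projective_line. smul (h L) (orbit_vector v (line_act g L)))"
    unfolding orbit_sum_def
    using sum_line_act[OF g, of "\<lambda>L. smul (h (line_act (inv\<^bsub>SL2\<^esub> g) L)) (orbit_vector v L)"]
    by (simp add: line_act_inv g)
  also have "\<dots> = (\<Sum>L\<in>projective_line. \<rho> g (smul (h L) (orbit_vector v L)))"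
    using v g by (intro sum.cong) (simp_all add: orbit_vector_line_act rho_scale orbit_vector_closed)
  also have "\<dots> = \<rho> g (orbit_sum v h)"
    unfolding orbit_sum_def using v g by (subst rho_sum) (simp_all add: orbit_vector_closed mem_simps)
  finally show ?thesis .
qed

lemma orbit_sum_eq:
  assumes v: "weight_vector (\<lambda>_. 1) v"
  shows "orbit_sum v h =
    smul (h line_at_infinity) v + unip_comb (\<lambda>x. h (affine_line x)) (\<rho> weyl v)"
proof -
  have "orbit_vector v line_at_infinity = v"
    using orbit_vector_line_act_infinity[OF v carriers(4)] weight_vector_memD[OF v]
    by (simp add: line_act_one rho_one)
  moreover have "orbit_vector v (affine_line x) = \<rho> (unip x) (\<rho> weyl v)" for x
    using orbit_vector_line_act_infinity[OF v carriers(5)[OF carriers(1) carriers(3)], of x]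
      weight_vector_memD[OF v]
    by (simp add: line_act_unip_weyl rho_mult carriers)
  ultimately show ?thesis
    by (simp add: orbit_sum_def sum_projective_line unip_comb_def)
qed

text \<open>The sum over the whole orbit is invariant and therefore vanishes.\<close>

lemma unip_sum_trivial_weight:
  assumes faithful: "inj_on \<rho> (carrier SL2)" and v: "weight_vector (\<lambda>_. 1) v"
  shows "unip_sum v = v"
proof -
  have "orbit_sum v (\<lambda>_. 1) = 0"
    using faithful orbit_sum_closed[OF v]
  proof (rule faithful_fixed_vector_zero)
    show "\<rho> g (orbit_sum v (\<lambda>_. 1)) = orbit_sum v (\<lambda>_. 1)" if "g \<in> carrier SL2" for g
      using orbit_sum_line_act[OF v that, of "\<lambda>_. 1"] by simp
  qed
  then have "v + unip_sum v = 0"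
    by (simp add: orbit_sum_eq[OF v] unip_sum_def)
  then show ?thesis
    using minus_unique neg_V by metis
qed

text \<open>The annihilator of \<open>weyl v\<close> in the group algebra of the unipotent subgroup is stable under
  translations. If it were nonzero it would contain a nonzero constant function, but the sum of
  all unipotent elements maps \<open>weyl v\<close> to \<open>v\<close>.\<close>

lemma unip_comb_eq_0_iff:
  assumes v: "weight_vector (\<lambda>_. 1) v" "unip_sum v = v"
  shows "unip_comb c (\<rho> weyl v) = 0 \<longleftrightarrow> c = (\<lambda>_. 0)"
proof
  let ?K = "{c. unip_comb c (\<rho> weyl v) = 0}"
  have mem: "\<rho> weyl v \<in> V"
    using weight_vector_memD[OF v(1)] by simp
  assume c: "unip_comb c (\<rho> weyl v) = 0"
  show "c = (\<lambda>_. 0)"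
  proof (rule ccontr)
    assume "c \<noteq> (\<lambda>_. 0)"
    then have "c \<noteq> 0"
      by (simp add: zero_fun_def)
    have "\<exists>d\<in>?K. d \<noteq> 0 \<and> (\<forall>a\<in>UNIV. (\<lambda>b. d (b - a)) = d)"
    proof (rule commuting_involutions_fixed_vector[where f = "\<lambda>a d b. d (b - a)" and ?x0.0 = c])
      show "(\<lambda>b. d (b - a)) \<in> ?K" if "d \<in> ?K" for a d
        using that unip_act_comb[OF mem, of a d] by (simp add: rho_zero carriers)
      show "d + e \<in> ?K" if "d \<in> ?K" "e \<in> ?K" for d e
        using that add_unip_comb[of d "\<rho> weyl v" e] by (simp add: plus_fun_def)
      show "(\<lambda>b. d (b - a - a)) = d" for d :: "'k \<Rightarrow> 'F" and a
        by (simp only: diff_diff_eq double_eq_0[OF char_k] diff_0_right)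
    qed (use c \<open>c \<noteq> 0\<close> in \<open>auto simp: plus_fun_def zero_fun_def double_F algebra_simps\<close>)
    then obtain d where d: "unip_comb d (\<rho> weyl v) = 0" "d \<noteq> 0"
      and const: "\<And>a. (\<lambda>b. d (b - a)) = d"
      by blast
    have d_const: "d b = d 0" for b
      using fun_cong[OF const[of b], of b] by simp
    then have "d = (\<lambda>a. d 0 * 1)"
      by auto
    then have "unip_comb d (\<rho> weyl v) = unip_comb (\<lambda>a. d 0 * 1) (\<rho> weyl v)"
      by (rule arg_cong)
    also have "\<dots> = smul (d 0) v"
      using v(2) by (simp only: unip_sum_def flip: scale_unip_comb)
    finally have "d 0 = 0"
      using d(1) weight_vector_memD(3)[OF v(1)] by simp
    then have "d = 0"
      using d_const by (auto simp: zero_fun_def)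
    with d(2) show False ..
  qed
qed (simp add: unip_comb_def)

lemma unip_comb_inject:
  assumes v: "weight_vector (\<lambda>_. 1) v" "unip_sum v = v"
  shows "unip_comb c (\<rho> weyl v) = unip_comb d (\<rho> weyl v) \<longleftrightarrow> c = d"
proof
  assume "unip_comb c (\<rho> weyl v) = unip_comb d (\<rho> weyl v)"
  then have "unip_comb (\<lambda>a. c a + d a) (\<rho> weyl v) = 0"
    by (simp add: double_V flip: add_unip_comb)
  then have "c a + d a = 0" for a
    unfolding unip_comb_eq_0_iff[OF v] by (rule fun_cong)
  then show "c = d"
    using minus_unique uminus_eq_self[OF char_F] by (metis ext)
qed simp

lemma unip_comb_generates:
  assumes v: "weight_vector (\<lambda>_. 1) v" "unip_sum v = v" and x: "x \<in> V"
  obtains c where "x = unip_comb c (\<rho> weyl v)"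
proof (rule unip_combs_of_weyl_weight_vector[OF v(1) _ x])
  show "v \<in> range (\<lambda>c. unip_comb c (\<rho> weyl v))"
    using v(2) unfolding unip_sum_def by (metis rangeI)
qed

lemma dim_eq_card_field:
  assumes v: "weight_vector (\<lambda>_. 1) v" "unip_sum v = v"
  shows "dim V = CARD('k)"
proof -
  let ?e = "\<lambda>a. \<rho> (unip a) (\<rho> weyl v)"
  have inj: "inj ?e"
  proof (rule injI)
    fix a b
    assume "?e a = ?e b"
    then have "(\<lambda>c. if c = a then 1 else 0 :: 'F) = (\<lambda>c. if c = b then 1 else 0)"
      unfolding unip_eq_unip_comb unip_comb_inject[OF v] .
    from fun_cong[OF this, of a] show "a = b"
      by (simp split: if_splits)
  qed
  have "independent (range ?e)"
  proof (rule independent_if_scalars_zero)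
    fix f x
    assume "(\<Sum>x\<in>range ?e. smul (f x) x) = 0" and x: "x \<in> range ?e"
    then have "unip_comb (\<lambda>a. f (?e a)) (\<rho> weyl v) = 0"
      by (simp add: sum.reindex[OF inj] unip_comb_def)
    then have "f (?e a) = 0" for a
      unfolding unip_comb_eq_0_iff[OF v] by (rule fun_cong)
    then show "f x = 0"
      using x by blast
  qed simp
  moreover have "range ?e \<subseteq> V"
    using weight_vector_memD[OF v(1)] by (auto simp: mem_simps)
  moreover have "V \<subseteq> span (range ?e)"
  proof
    fix x
    assume "x \<in> V"
    with v obtain c where "x = unip_comb c (\<rho> weyl v)"
      by (rule unip_comb_generates)
    then show "x \<in> span (range ?e)"
      unfolding unip_comb_def by (simp only:) (intro span_sum span_scale span_base rangeI)
  qed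
  ultimately have "dim V = card (range ?e)"
    using basis_card_eq_dim by simp
  then show ?thesis
    by (simp add: card_image[OF inj])
qed

text \<open>In the basis of the vectors \<open>unip x weyl v\<close>, whose sum is \<open>v\<close>, the map sends \<open>h\<close> to the
  coordinates \<open>h \<infinity> + h x\<close>. The sum of these coordinates is the sum of the \<open>h x\<close>, as \<open>q\<close> is even, and
  for functions of total sum zero this recovers \<open>h \<infinity>\<close>.\<close>

lemma bij_orbit_sum:
  assumes v: "weight_vector (\<lambda>_. 1) v" "unip_sum v = v"
  shows "bij_betw (orbit_sum v) steinberg_space V"
proof -
  have eq: "orbit_sum v h = unip_comb (\<lambda>x. h line_at_infinity + h (affine_line x)) (\<rho> weyl v)" for h
  proof -
    have "smul (h line_at_infinity) v = unip_comb (\<lambda>_. h line_at_infinity * 1) (\<rho> weyl v)"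
      using v(2) by (simp only: unip_sum_def flip: scale_unip_comb)
    then show ?thesis
      by (simp add: orbit_sum_eq[OF v(1)] add_unip_comb)
  qed
  have zero_sum: "h line_at_infinity + (\<Sum>x\<in>UNIV. h (affine_line x)) = 0"
    if "h \<in> steinberg_space" for h :: "('k^2) set \<Rightarrow> 'F"
    using that by (simp add: steinberg_space_def sum_projective_line)
  show ?thesis
  proof (rule bij_betw_imageI)
    show "inj_on (orbit_sum v) steinberg_space"
    proof (rule inj_onI)
      fix h k :: "('k^2) set \<Rightarrow> 'F"
      assume hk: "h \<in> steinberg_space" "k \<in> steinberg_space" and "orbit_sum v h = orbit_sum v k"
      then have "(\<lambda>x. h line_at_infinity + h (affine_line x)) =
          (\<lambda>x. k line_at_infinity + k (affine_line x))"
        unfolding eq unip_comb_inject[OF v] by simp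
      then have affine: "h line_at_infinity + h (affine_line x) =
          k line_at_infinity + k (affine_line x)" for x
        by (rule fun_cong)
      have "(\<Sum>x\<in>UNIV. h line_at_infinity + h (affine_line x)) = (\<Sum>x\<in>UNIV. h (affine_line x))"
        "(\<Sum>x\<in>UNIV. k line_at_infinity + k (affine_line x)) = (\<Sum>x\<in>UNIV. k (affine_line x))"
        by (simp_all add: sum.distrib card_F)
      then have "(\<Sum>x\<in>UNIV. h (affine_line x)) = (\<Sum>x\<in>UNIV. k (affine_line x))"
        by (simp add: affine)
      then have inf: "h line_at_infinity = k line_at_infinity"
        using zero_sum[OF hk(1)] zero_sum[OF hk(2)] by (metis add_right_cancel)
      show "h = k"
      proof
        fix L
        show "h L = k L"
        proof (cases "L \<in> projective_line")
          case True
          then show ?thesis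
            using inf affine by (auto simp: projective_line_eq[OF char_k])
        next
          case False
          then show ?thesis
            using hk by (simp add: steinberg_space_def)
        qed
      qed
    qed
    show "orbit_sum v ` steinberg_space = V"
    proof (intro equalityI subsetI)
      show "x \<in> V" if "x \<in> orbit_sum v ` steinberg_space" for x
        using that orbit_sum_closed[OF v(1)] by blast
      fix x
      assume "x \<in> V"
      with v obtain c where c: "x = unip_comb c (\<rho> weyl v)"
        by (rule unip_comb_generates)
      define s where "s = (\<Sum>a\<in>UNIV. c a)"
      \<comment> \<open>The value at infinity is forced by the vanishing of the total sum, as the field has even
        cardinality.\<close>
      define h where "h L = (if L = line_at_infinity then s
        else if L \<in> range affine_line then s + c (inv_into UNIV affine_line L) else 0)" for L
      have h_affine: "h (affine_line a) = s + c a" and h_inf: "h line_at_infinity = s" for a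
        by (simp_all add: h_def affine_line_neq_infinity inv_f_f[OF inj_affine_line])
      have "h L = 0" if "L \<notin> projective_line" for L
        using that by (auto simp: h_def projective_line_eq[OF char_k])
      moreover have "(\<Sum>L\<in>projective_line. h L) = 0"
        by (simp add: sum_projective_line h_affine h_inf sum.distrib card_F double_F flip: s_def)
      ultimately have "h \<in> steinberg_space"
        by (simp add: steinberg_space_def)
      moreover have "orbit_sum v h = x"
        by (simp add: eq h_affine h_inf c double_F flip: add.assoc)
      ultimately show "x \<in> orbit_sum v ` steinberg_space"
        by blast
    qed
  qed
qed

lemma steinberg_space_closed:
  fixes h k :: "('k^2) set \<Rightarrow> 'F"
  assumes "h \<in> steinberg_space"
  shows "k \<in> steinberg_space \<Longrightarrow> h + k \<in> steinberg_space" "fun_scale c h \<in> steinberg_space"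
    "g \<in> carrier SL2 \<Longrightarrow> steinberg_action g h \<in> steinberg_space"
    "steinberg_action g h = (\<lambda>L. h (line_act (inv\<^bsub>SL2\<^esub> g) L))"
proof -
  show act: "steinberg_action g h = (\<lambda>L. h (line_act (inv\<^bsub>SL2\<^esub> g) L))"
    using assms by (simp add: steinberg_action_def line_act_def)
  show "h + k \<in> steinberg_space" if "k \<in> steinberg_space"
    using assms that by (simp add: steinberg_space_def sum.distrib)
  show "fun_scale c h \<in> steinberg_space"
    using assms by (simp add: steinberg_space_def fun_scale_def flip: sum_distrib_left)
  show "steinberg_action g h \<in> steinberg_space" if "g \<in> carrier SL2"
    unfolding act using assms that
    by (simp add: steinberg_space_def line_act_projective_line inv_SL2 sum_line_act)
qed

lemma rep_iso_steinberg:
  assumes v: "weight_vector (\<lambda>_. 1) v" "unip_sum v = v"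
  shows "rep_iso SL2 smul V \<rho> fun_scale (steinberg_space :: (('k^2) set \<Rightarrow> 'F) set) steinberg_action"
proof -
  let ?S = "steinberg_space :: (('k^2) set \<Rightarrow> 'F) set"
  let ?\<phi> = "inv_into ?S (orbit_sum v)"
  have bij: "bij_betw (orbit_sum v) ?S V"
    by (rule bij_orbit_sum[OF v])
  have inverse: "?\<phi> (orbit_sum v h) = h" if "h \<in> ?S" for h
    using bij_betw_inv_into_left[OF bij that] .
  have surj: "\<exists>h\<in>?S. x = orbit_sum v h" if "x \<in> V" for x
    using that bij_betw_imp_surj_on[OF bij] by blast
  have "?\<phi> (x + y) = ?\<phi> x + ?\<phi> y" if "x \<in> V" "y \<in> V" for x y
  proof -
    obtain h k where hk: "h \<in> ?S" "k \<in> ?S" and "x = orbit_sum v h" "y = orbit_sum v k"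
      using surj[OF \<open>x \<in> V\<close>] surj[OF \<open>y \<in> V\<close>] by blast
    moreover have "orbit_sum v h + orbit_sum v k = orbit_sum v (h + k)"
      by (simp add: orbit_sum_def scale_left_distrib sum.distrib)
    ultimately show ?thesis
      by (simp add: inverse steinberg_space_closed)
  qed
  moreover have "?\<phi> (smul c x) = fun_scale c (?\<phi> x)" if "x \<in> V" for c x
  proof -
    obtain h where h: "h \<in> ?S" "x = orbit_sum v h"
      using surj[OF \<open>x \<in> V\<close>] by blast
    have "smul c (orbit_sum v h) = orbit_sum v (fun_scale c h)"
      by (simp add: orbit_sum_def fun_scale_def scale_sum_right)
    with h show ?thesis
      by (simp add: inverse steinberg_space_closed)
  qed
  moreover have "?\<phi> (\<rho> g x) = steinberg_action g (?\<phi> x)" if g: "g \<in> carrier SL2" and "x \<in> V" for g x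
  proof -
    obtain h where h: "h \<in> ?S" "x = orbit_sum v h"
      using surj[OF \<open>x \<in> V\<close>] by blast
    have "\<rho> g (orbit_sum v h) = orbit_sum v (steinberg_action g h)"
      using orbit_sum_line_act[OF v(1) g, of h] by (simp add: steinberg_space_closed(4)[OF h(1)])
    with h g show ?thesis
      by (simp add: inverse steinberg_space_closed(3))
  qed
  ultimately show ?thesis
    unfolding rep_iso_def using bij_betw_inv_into[OF bij] by (intro exI[of _ ?\<phi>]) blast
qed

end

section \<open>Representations with traces in the prime field\<close>

text \<open>The sum \<open>1 + 1\<close> lies in the subfield and differs from \<open>1\<close>.\<close>

lemma char_2_if_algebraic_closure_of_01:
  assumes "algebraic_closure (ring_of_type_algebra :: 'F::field ring) {0, 1}"
  shows "(1::'F) + 1 = 0"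
proof -
  have "subfield {0, 1} (ring_of_type_algebra :: 'F ring)"
    using assms by (rule algebraic_closure.axioms)
  then have "subring {0, 1} (ring_of_type_algebra :: 'F ring)"
    by (rule subfieldE)
  then have "(1::'F) \<oplus>\<^bsub>ring_of_type_algebra\<^esub> 1 \<in> {0, 1}"
    by (rule subringE) simp_all
  then have "(1::'F) + 1 = 0 \<or> (1::'F) + 1 = 1"
    by (simp add: ring_of_type_algebra_def del: one_add_one)
  then show ?thesis
    by (metis add_cancel_left_right one_neq_zero)
qed

text \<open>Translation by \<open>1\<close> permutes the ring, so it does not change the sum of all elements.\<close>

lemma of_nat_card_eq_0: "of_nat CARD('k) = (0::'k::{ring_1,finite})"
proof -
  have "(\<Sum>x\<in>UNIV. x) = (\<Sum>x\<in>UNIV. x + (1::'k))"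
    by (rule sum.reindex_bij_witness[of _ "\<lambda>x. x + 1" "\<lambda>x. x - 1"]) auto
  then show ?thesis
    by (simp add: sum.distrib)
qed

theorem theorem6p2:
  fixes q :: nat
    and smul :: "'F::alg_closed_field \<Rightarrow> 'v::ab_group_add \<Rightarrow> 'v"
    and V :: "'v set"
    and \<rho> :: "'k::{field,finite}^2^2 \<Rightarrow> 'v \<Rightarrow> 'v"
  assumes "CARD('k) = q" and "\<exists>n. q = 2 ^ n" and "q \<ge> 8"
    and "algebraic_closure (ring_of_type_algebra :: 'F ring) {0, 1}"
    and "absolutely_irreducible_rep smul SL2 V \<rho>"
    and "faithful_action SL2 V \<rho>"
    and "\<forall>g\<in>carrier SL2. endo_trace smul V (\<rho> g) \<in> {0, 1}"
  shows "vector_space.dim smul V = q \<and>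
    rep_iso SL2 smul V \<rho>
      fun_scale (steinberg_space :: (('k^2) set \<Rightarrow> 'F) set) steinberg_action"
proof -
  obtain n where n: "q = 2 ^ n"
    using assms(2) by blast
  have "n \<noteq> 0"
    using n assms(3) by (cases n) auto
  have "(2::'k) ^ n = 0"
    using of_nat_card_eq_0[where 'k = 'k] assms(1) n by simp
  then have char_k: "(1::'k) + 1 = 0"
    by (simp add: one_add_one)
  have irr: "irreducible_rep smul SL2 V \<rho>"
    using assms(5) by (rule absolutely_irreducible_imp_irreducible)
  interpret linear_rep smul SL2 V \<rho>
    using irr by (simp add: irreducible_rep_def)
  interpret char2_SL2_rep smul V \<rho>
  proof unfold_locales
    show "(1::'F) + 1 = 0"
      using assms(4) by (rule char_2_if_algebraic_closure_of_01)
    show "even CARD('k)"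
      using assms(1) n \<open>n \<noteq> 0\<close> by simp
  qed (use char_k irr in \<open>auto simp: irreducible_rep_def\<close>)
  have faithful: "inj_on \<rho> (carrier SL2)"
    using assms(6) by (rule faithful_action.faithful)
  obtain v where v: "weight_vector (\<lambda>_. 1) v"
    using exists_vector_of_trivial_weight assms(7) by blast
  have "unip_sum v = v"
    using faithful v by (rule unip_sum_trivial_weight)
  then show ?thesis
    using dim_eq_card_field[OF v] rep_iso_steinberg[OF v] assms(1) by simp
qed

end
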